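(* Let $\pi$ be any (fixed) vincular permutation pattern. Let $s$ be the greatest number of inversions in a supercomponent of $\pi$, and let $s'$ be the greatest number of inversions in a supercomponent of $\overline{\pi}$. Let $m=m(n)$ and let $\boldsymbol{\sigma}_{n,m}$ be a uniformly random $n$-permutation with exactly $m$ inversions. (i) If $s>0$, then \[ \lim_{n\to\infty}\mathbb{P}\big[\boldsymbol{\sigma}_{n,m}\text{ contains }\pi\big]= \begin{cases} 0 & \text{if } m\ll n^{1-1/s},\\ 1 & \text{if } n^{1-1/s}\ll m\ll n. \end{cases} \] (ii) If $s'>0$, then \[ \lim_{n\to\infty}\mathbb{P}\big[\boldsymbol{\sigma}_{n,m}\text{ contains }\pi\big]= \begin{cases} 1 & \text{if } n\gg \binom n2-m\gg n^{1-1/s'},\\ 0 & \text{if } \binom n2-m\ll n^{1-1/s'}. \end{cases} \]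
   Context: An $n$-permutation is an arrangement $\sigma=\sigma(1)\ldots\sigma(n)$ of $[n]=\{1,\dots,n\}$. Its complement $\overline{\sigma}$ is given by $\overline{\sigma}(i)=n+1-\sigma(i)$. An inversion of $\sigma$ is a pair $i<j$ with $\sigma(i)>\sigma(j)$. For an integer $m$ with $0\le m\le\binom n2$, $\boldsymbol{\sigma}_{n,m}$ is chosen uniformly at random from the set of $n$-permutations with exactly $m$ inversions. Here $m=m(n)$ is an integer-valued function of $n$. A vincular pattern is a permutation $\pi$ of some length $k$ together with a set $A\subseteq[k-1]$ of adjacency requirements: $t\in A$ means that the $t$th and $(t+1)$th terms of the pattern are required to be adjacent. A permutation $\sigma$ contains the vincular pattern if there are indices $i_1<\dots<i_k$ such that $\sigma(i_1),\dots,\sigma(i_k)$ have the same relative order as $\pi$ and $i_{t+1}=i_t+1$ for every $t\in A$. The complement $\overline{\pi}$ of a vincular pattern is the complement of the underlying permutation, with the same adjacency requirements $A$. The direct sum $\sigma\oplus\tau$ of permutations of lengths $k,\ell$ is the permutation of length $k+\ell$ with $(\sigma\oplus\tau)(i)=\sigma(i)$ for $i\le k$ and $(\sigma\oplus\tau)(i)=k+\tau(i-k)$ for $k+1\le i\le k+\ell$. An $n$-permutation $\sigma$ is indecomposable if there is no $1\le k<n$ with $\{\sigma(1),\dots,\sigma(k)\}=\{1,\dots,k\}$. Every permutation is uniquely a direct sum $\alpha_1\oplus\dots\oplus\alpha_r$ of indecomposable permutations (its sum decomposition). Supercomponents: a vincular pattern with sum decomposition $\alpha_1\oplus\dots\oplus\alpha_r$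 has a unique (possibly coarser) representation as a direct sum $\beta_1\oplus\dots\oplus\beta_\ell$ in which each $\beta_j$ is a direct sum of a run of consecutive $\alpha_i$'s, and $\alpha_i$ and $\alpha_{i+1}$ belong to the same $\beta_j$ if and only if the last term of $\alpha_i$ is required to be adjacent to the first term of $\alpha_{i+1}$. The permutations $\beta_1,\dots,\beta_\ell$ are the supercomponents of the pattern. Notation: $f\ll g$ (equivalently $g\gg f$) means $\lim_{n\to\infty}f/g=0$. *)

theory Defs
  imports "HOL-Probability.Probability" "HOL-Combinatorics.Multiset_Permutations"
begin

text \<open>
  An \<open>n\<close>-permutation is the list \<open>[\<sigma>(1), \<dots>, \<sigma>(n)]\<close>, an element of
  \<open>permutations_of_set {1..n}\<close>. Values are therefore 1-based and list positions 0-based: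
  \<open>\<sigma>(i)\<close> is \<open>\<sigma> ! (i - 1)\<close>.
\<close>

definition is_perm :: "nat list \<Rightarrow> bool" where
  "is_perm \<sigma> \<longleftrightarrow> \<sigma> \<in> permutations_of_set {1..length \<sigma>}"

definition complement :: "nat list \<Rightarrow> nat list" where
  "complement \<sigma> = map (\<lambda>x. length \<sigma> + 1 - x) \<sigma>"

definition num_inversions :: "nat list \<Rightarrow> nat" where
  "num_inversions \<sigma> = card {(i, j). i < j \<and> j < length \<sigma> \<and> \<sigma> ! i > \<sigma> ! j}"

definition perms_with_inversions :: "nat \<Rightarrow> nat \<Rightarrow> nat list set" where
  "perms_with_inversions n m = {\<sigma> \<in> permutations_of_set {1..n}. num_inversions \<sigma> = m}"

definition random_perm :: "nat \<Rightarrow> nat \<Rightarrow> nat list pmf" where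
  "random_perm n m = pmf_of_set (perms_with_inversions n m)"

text \<open>
  Adjacency requirements \<open>A\<close> keep 1-based indices: \<open>t \<in> A\<close> concerns the list positions
  \<open>t - 1\<close> and \<open>t\<close>.
\<close>

definition vincular_pattern :: "nat list \<Rightarrow> nat set \<Rightarrow> bool" where
  "vincular_pattern \<pi> A \<longleftrightarrow> \<pi> \<noteq> [] \<and> is_perm \<pi> \<and> A \<subseteq> {1..length \<pi> - 1}"

definition contains_vincular :: "nat list \<Rightarrow> nat list \<Rightarrow> nat set \<Rightarrow> bool" where
  "contains_vincular \<sigma> \<pi> A \<longleftrightarrow>
     (\<exists>f. strict_mono_on {..<length \<pi>} f \<and>
          f ` {..<length \<pi>} \<subseteq> {..<length \<sigma>} \<and>
          (\<forall>a<length \<pi>. \<forall>b<length \<pi>. \<sigma> ! f a < \<sigma> ! f b \<longleftrightarrow> \<pi> ! a < \<pi> ! b) \<and>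
          (\<forall>t\<in>A. f t = f (t - 1) + 1))"

definition direct_sum :: "nat list \<Rightarrow> nat list \<Rightarrow> nat list" (infixr \<open>\<oplus>\<close> 65) where
  "\<sigma> \<oplus> \<tau> = \<sigma> @ map (\<lambda>x. length \<sigma> + x) \<tau>"

definition direct_sums :: "nat list list \<Rightarrow> nat list" where
  "direct_sums \<alpha>s = foldr (\<oplus>) \<alpha>s []"

definition indecomposable :: "nat list \<Rightarrow> bool" where
  "indecomposable \<sigma> \<longleftrightarrow> \<sigma> \<noteq> [] \<and> is_perm \<sigma> \<and>
     \<not> (\<exists>k. 1 \<le> k \<and> k < length \<sigma> \<and> set (take k \<sigma>) = {1..k})"

definition is_sum_decomposition :: "nat list \<Rightarrow> nat list list \<Rightarrow> bool" where
  "is_sum_decomposition \<pi> \<alpha>s \<longleftrightarrow> (\<forall>\<alpha>\<in>set \<alpha>s. indecomposable \<alpha>) \<and> direct_sums \<alpha>s = \<pi>"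

text \<open>
  The map \<open>b\<close> sends the index of a component \<open>\<alpha> i\<close> to the index of the supercomponent containing
  it. The last term of \<open>\<alpha> i\<close> has the 1-based position
  \<open>length (\<alpha> 0) + \<dots> + length (\<alpha> i)\<close> in \<open>\<pi>\<close>.
\<close>

definition are_supercomponents :: "nat list \<Rightarrow> nat set \<Rightarrow> nat list list \<Rightarrow> bool" where
  "are_supercomponents \<pi> A \<beta>s \<longleftrightarrow>
     (\<exists>\<alpha>s b. is_sum_decomposition \<pi> \<alpha>s \<and>
        mono_on {..<length \<alpha>s} b \<and>
        b ` {..<length \<alpha>s} = {..<length \<beta>s} \<and>
        (\<forall>i. Suc i < length \<alpha>s \<longrightarrow>
           (b i = b (Suc i) \<longleftrightarrow> sum_list (map length (take (Suc i) \<alpha>s)) \<in> A)) \<and>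
        (\<forall>j<length \<beta>s. \<beta>s ! j = direct_sums (nths \<alpha>s {i. b i = j})))"

definition supercomponents :: "nat list \<Rightarrow> nat set \<Rightarrow> nat list list" where
  "supercomponents \<pi> A = (THE \<beta>s. are_supercomponents \<pi> A \<beta>s)"

definition max_super_inversions :: "nat list \<Rightarrow> nat set \<Rightarrow> nat" where
  "max_super_inversions \<pi> A = Max (num_inversions ` set (supercomponents \<pi> A))"

text \<open>
  Little-o rather than a limit of the quotient \<open>f n / g n\<close>: division by zero would make
  the latter vacuously true where \<open>g\<close> vanishes.
\<close>

abbreviation much_less :: "(nat \<Rightarrow> real) \<Rightarrow> (nat \<Rightarrow> real) \<Rightarrow> bool" (infix \<open>\<lless>\<close> 50) where
  "f \<lless> g \<equiv> f \<in> o(g)"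

lemma direct_sums_simps [simp]:
  "direct_sums [] = []"
  "direct_sums (\<alpha> # \<alpha>s) = \<alpha> \<oplus> direct_sums \<alpha>s"
  by (simp_all add: direct_sums_def)

lemma is_perm_iff: "is_perm \<sigma> \<longleftrightarrow> set \<sigma> = {1..length \<sigma>}"
proof
  assume "set \<sigma> = {1..length \<sigma>}"
  moreover from this have "card (set \<sigma>) = length \<sigma>" by simp
  ultimately show "is_perm \<sigma>"
    unfolding is_perm_def permutations_of_set_def by (auto intro: card_distinct)
qed (simp add: is_perm_def permutations_of_set_def)

lemma is_sum_decomposition_unique:
  "is_sum_decomposition \<pi> \<alpha>s \<Longrightarrow> is_sum_decomposition \<pi> \<gamma>s \<Longrightarrow> \<alpha>s = \<gamma>s"
proof (induction \<alpha>s arbitrary: \<pi> \<gamma>s)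
  case Nil
  then show ?case
    by (cases \<gamma>s) (auto simp: is_sum_decomposition_def direct_sum_def indecomposable_def)
next
  case (Cons \<alpha> \<alpha>s)
  have a: "indecomposable \<alpha>" and eq: "\<pi> = \<alpha> \<oplus> direct_sums \<alpha>s"
    using Cons.prems(1) by (auto simp: is_sum_decomposition_def)
  have "\<gamma>s \<noteq> []"
    using Cons.prems(2) a eq by (auto simp: is_sum_decomposition_def direct_sum_def indecomposable_def)
  then obtain \<gamma> \<delta>s where g: "\<gamma>s = \<gamma> # \<delta>s" by (cases \<gamma>s) auto
  have c: "indecomposable \<gamma>" and eq': "\<pi> = \<gamma> \<oplus> direct_sums \<delta>s"
    using Cons.prems(2) g by (auto simp: is_sum_decomposition_def)
  have key: "\<not> length x < length y"
    if "indecomposable x" "indecomposable y" "x \<oplus> u = y \<oplus> v" for x y u v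
  proof
    assume l: "length x < length y"
    have "take (length x) y = take (length x) (y \<oplus> v)"
      using l by (simp add: direct_sum_def)
    also have "\<dots> = x" using that(3)[symmetric] by (simp add: direct_sum_def)
    finally have "set (take (length x) y) = {1..length x}"
      using that(1) by (simp add: indecomposable_def is_perm_iff)
    moreover have "1 \<le> length x" using that(1) by (cases x) (auto simp: indecomposable_def)
    ultimately show False using that(2) l by (auto simp: indecomposable_def)
  qed
  have "length \<alpha> = length \<gamma>"
    using key[OF a c] key[OF c a] eq eq' by (metis linorder_neqE_nat)
  moreover have "\<alpha> @ map (\<lambda>x. length \<alpha> + x) (direct_sums \<alpha>s) =
                 \<gamma> @ map (\<lambda>x. length \<gamma> + x) (direct_sums \<delta>s)"
    using eq eq' by (metis direct_sum_def)
  ultimately have "\<alpha> = \<gamma>" and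
    m: "map (\<lambda>x. length \<alpha> + x) (direct_sums \<alpha>s) = map (\<lambda>x. length \<alpha> + x) (direct_sums \<delta>s)"
    by simp_all
  have "direct_sums \<alpha>s = direct_sums \<delta>s"
    using m by (subst (asm) inj_map_eq_map) (auto simp: inj_def)
  then have "\<alpha>s = \<delta>s"
    using Cons.prems g by (intro Cons.IH[of "direct_sums \<alpha>s"]) (auto simp: is_sum_decomposition_def)
  with \<open>\<alpha> = \<gamma>\<close> g show ?case by simp
qed

lemma is_sum_decomposition_exists:
  "is_perm \<pi> \<Longrightarrow> \<exists>\<alpha>s. is_sum_decomposition \<pi> \<alpha>s"
proof (induction "length \<pi>" arbitrary: \<pi> rule: less_induct)
  case less
  show ?case
  proof (cases "\<pi> = []")
    case True
    then show ?thesis by (intro exI[of _ "[]"]) (simp add: is_sum_decomposition_def)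
  next
    case False
    define P where "P k \<longleftrightarrow> 1 \<le> k \<and> k \<le> length \<pi> \<and> set (take k \<pi>) = {1..k}" for k
    define k where "k = (LEAST k. P k)"
    have "P (length \<pi>)"
      using less.prems False by (cases \<pi>) (auto simp: P_def is_perm_iff)
    then have Pk: "P k" unfolding k_def by (rule LeastI)
    have least: "\<not> P j" if "j < k" for j using that unfolding k_def by (rule not_less_Least)
    have lk: "length (take k \<pi>) = k" using Pk by (simp add: P_def)
    have ind: "indecomposable (take k \<pi>)"
      using Pk least lk unfolding indecomposable_def
      by (auto simp: is_perm_iff P_def min_def split: if_splits)
    have dist: "distinct \<pi>" and setp: "set \<pi> = {1..length \<pi>}"
      using less.prems by (auto simp: is_perm_def permutations_of_set_def)
    have disj: "set (take k \<pi>) \<inter> set (drop k \<pi>) = {}"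
      using dist by (simp add: set_take_disj_set_drop_if_distinct)
    have un: "set (take k \<pi>) \<union> set (drop k \<pi>) = {1..length \<pi>}"
      using setp by (metis append_take_drop_id set_append)
    have "set (drop k \<pi>) = {1..length \<pi>} - set (take k \<pi>)"
      using disj un by blast
    also have "\<dots> = {k + 1..length \<pi>}" using Pk by (auto simp: P_def)
    finally have sd: "set (drop k \<pi>) = {k + 1..length \<pi>}" .
    define \<rho> where "\<rho> = map (\<lambda>x. x - k) (drop k \<pi>)"
    have "set \<rho> = {1..length \<rho>}"
    proof -
      have "set \<rho> = (\<lambda>x. x - k) ` {k + 1..length \<pi>}" by (simp add: \<rho>_def sd)
      also have "\<dots> = {1..length \<pi> - k}"
      proof
        show "{1..length \<pi> - k} \<subseteq> (\<lambda>x. x - k) ` {k + 1..length \<pi>}"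
        proof
          fix y assume "y \<in> {1..length \<pi> - k}"
          then show "y \<in> (\<lambda>x. x - k) ` {k + 1..length \<pi>}"
            by (intro image_eqI[of _ _ "y + k"]) auto
        qed
      qed auto
      finally show ?thesis by (simp add: \<rho>_def)
    qed
    moreover have "length \<rho> < length \<pi>" using Pk by (auto simp: \<rho>_def P_def)
    ultimately obtain \<alpha>s where as: "is_sum_decomposition \<rho> \<alpha>s"
      using less.hyps by (auto simp: is_perm_iff)
    have "map (\<lambda>x. k + x) \<rho> = drop k \<pi>"
      unfolding \<rho>_def map_map by (rule map_idI) (use sd in auto)
    then have "take k \<pi> \<oplus> \<rho> = \<pi>"
      unfolding direct_sum_def lk by simp
    then show ?thesis
      using as ind by (intro exI[of _ "take k \<pi> # \<alpha>s"]) (auto simp: is_sum_decomposition_def)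
  qed
qed

lemma block_map_unique:
  fixes b :: "nat \<Rightarrow> nat"
  assumes "mono_on {..<r} b" "b ` {..<r} = {..<l}"
    and "\<And>i. Suc i < r \<Longrightarrow> b i = b (Suc i) \<longleftrightarrow> Q i"
  shows "i < r \<Longrightarrow> b i = card {t. t < i \<and> \<not> Q t}"
proof (induction i)
  case 0
  have "b 0 \<in> {..<l}" using assms(2) 0 by blast
  then have "0 \<in> b ` {..<r}" using assms(2) by auto
  then obtain i where "i < r" "b i = 0" by auto
  then have "b 0 \<le> 0" using mono_onD[OF assms(1), of 0 i] 0 by auto
  then show ?case by simp
next
  case (Suc i)
  have le: "b i \<le> b (Suc i)" using mono_onD[OF assms(1), of i "Suc i"] Suc.prems by auto
  show ?case
  proof (cases "Q i")
    case True
    then have "{t. t < Suc i \<and> \<not> Q t} = {t. t < i \<and> \<not> Q t}" by (auto simp: less_Suc_eq)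
    with True show ?thesis using Suc assms(3)[of i] by simp
  next
    case False
    then have "{t. t < Suc i \<and> \<not> Q t} = insert i {t. t < i \<and> \<not> Q t}" by (auto simp: less_Suc_eq)
    then have c: "card {t. t < Suc i \<and> \<not> Q t} = Suc (b i)" using Suc by simp
    have lt: "b i < b (Suc i)" using False assms(3)[of i] Suc.prems le by simp
    have "b (Suc i) \<in> {..<l}" using assms(2) Suc.prems by blast
    then have "Suc (b i) \<in> b ` {..<r}" using lt assms(2) by auto
    then obtain j where j: "j < r" "b j = Suc (b i)" by auto
    have "\<not> j \<le> i" using mono_onD[OF assms(1), of j i] j Suc.prems by auto
    then have "b (Suc i) \<le> b j" using mono_onD[OF assms(1), of "Suc i" j] j Suc.prems by auto
    then show ?thesis using c j lt by simp
  qed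
qed

lemma block_map_exists:
  fixes r :: nat and Q :: "nat \<Rightarrow> bool"
  defines "b \<equiv> \<lambda>i. card {t. t < i \<and> \<not> Q t}"
  shows "mono_on {..<r} b" "\<exists>l. b ` {..<r} = {..<l}" "b i = b (Suc i) \<longleftrightarrow> Q i"
proof -
  have step: "b (Suc i) = (if Q i then b i else Suc (b i))" for i
  proof (cases "Q i")
    case True
    then have "{t. t < Suc i \<and> \<not> Q t} = {t. t < i \<and> \<not> Q t}" by (auto simp: less_Suc_eq)
    with True show ?thesis by (simp add: b_def)
  next
    case False
    then have "{t. t < Suc i \<and> \<not> Q t} = insert i {t. t < i \<and> \<not> Q t}" by (auto simp: less_Suc_eq)
    with False show ?thesis by (simp add: b_def)
  qed
  show "b i = b (Suc i) \<longleftrightarrow> Q i" by (simp add: step)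
  have "mono b" by (rule mono_iff_le_Suc[THEN iffD2]) (simp add: step)
  then show "mono_on {..<r} b" by (simp add: monotone_on_def mono_def)
  have "b ` {..n} = {..b n}" for n
    by (induction n) (auto simp: atMost_Suc step, auto simp: b_def)
  then show "\<exists>l. b ` {..<r} = {..<l}"
    by (cases r) (simp add: exI[of _ 0], metis lessThan_Suc_atMost)
qed

lemma are_supercomponents_ex1:
  assumes "is_perm \<pi>"
  shows "\<exists>!\<beta>s. are_supercomponents \<pi> A \<beta>s"
proof -
  obtain \<alpha>s where as: "is_sum_decomposition \<pi> \<alpha>s"
    using is_sum_decomposition_exists[OF assms] by blast
  define Q where "Q i \<longleftrightarrow> sum_list (map length (take (Suc i) \<alpha>s)) \<in> A" for i
  define b where "b i = card {t. t < i \<and> \<not> Q t}" for i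
  obtain l where l: "b ` {..<length \<alpha>s} = {..<l}"
    using block_map_exists(2)[where Q = Q and r = "length \<alpha>s"] unfolding b_def by blast
  define B where "B = map (\<lambda>j. direct_sums (nths \<alpha>s {i. b i = j})) [0..<l]"
  have "are_supercomponents \<pi> A B"
    unfolding are_supercomponents_def
    using as l block_map_exists(1)[where Q = Q and r = "length \<alpha>s"] block_map_exists(3)[where Q = Q]
    by (intro exI[of _ \<alpha>s] exI[of _ b]) (auto simp: B_def b_def[abs_def] Q_def)
  moreover have "\<beta>s = B" if bs: "are_supercomponents \<pi> A \<beta>s" for \<beta>s
  proof -
    obtain \<gamma>s b' where b'': "is_sum_decomposition \<pi> \<gamma>s \<and>
        mono_on {..<length \<gamma>s} b' \<and> b' ` {..<length \<gamma>s} = {..<length \<beta>s} \<and>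
        (\<forall>i. Suc i < length \<gamma>s \<longrightarrow>
           (b' i = b' (Suc i) \<longleftrightarrow> sum_list (map length (take (Suc i) \<gamma>s)) \<in> A)) \<and>
        (\<forall>j<length \<beta>s. \<beta>s ! j = direct_sums (nths \<gamma>s {i. b' i = j}))"
      using bs[unfolded are_supercomponents_def] by (elim exE) (rule that)
    have "\<gamma>s = \<alpha>s" using is_sum_decomposition_unique[OF conjunct1[OF b''] as] .
    then have b': "mono_on {..<length \<alpha>s} b'" "b' ` {..<length \<alpha>s} = {..<length \<beta>s}"
      "\<And>i. Suc i < length \<alpha>s \<Longrightarrow> b' i = b' (Suc i) \<longleftrightarrow> Q i"
      "\<And>j. j < length \<beta>s \<Longrightarrow> \<beta>s ! j = direct_sums (nths \<alpha>s {i. b' i = j})"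
      using b'' by (simp_all add: Q_def)
    have eq: "b' i = b i" if "i < length \<alpha>s" for i
      using block_map_unique[where Q = Q, OF b'(1-3) that] by (simp add: b_def)
    have "length \<beta>s = l" using l b'(2) eq by (metis image_cong lessThan_iff lessThan_eq_iff)
    moreover have "nths \<alpha>s {i. b' i = j} = nths \<alpha>s {i. b i = j}" for j
      unfolding nths_def by (intro arg_cong[where f = "map fst"] filter_cong)
        (auto simp: set_zip eq)
    ultimately show ?thesis using b'(4) by (intro nth_equalityI) (auto simp: B_def)
  qed
  ultimately show ?thesis by blast
qed

lemma are_supercomponents_supercomponents:
  "is_perm \<pi> \<Longrightarrow> are_supercomponents \<pi> A (supercomponents \<pi> A)"
  unfolding supercomponents_def by (rule theI') (rule are_supercomponents_ex1)

end

theory Submission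
  imports Defs
begin

text \<open>
  A permutation \<open>\<sigma>\<close> is encoded by its inversion table: entry \<open>j\<close> is the number of positions
  \<open>i < j\<close> with \<open>\<sigma> ! i > \<sigma> ! j\<close>. This is a bijection between the permutations of \<open>[n]\<close> with
  \<open>m\<close> inversions and the sequences \<open>e\<close> with \<open>e i \<le> i\<close> and sum \<open>m\<close>. When \<open>m\<close> is small compared
  with \<open>n\<close>, a uniformly random such sequence resembles \<open>m\<close> units thrown independently into \<open>n\<close>
  cells, so a prescribed configuration of \<open>s\<close> units inside a window of bounded length appears at a
  given place with probability of order \<open>(m / n) ^ s\<close>, and somewhere with expected number of order
  \<open>n * (m / n) ^ s\<close>. This quantity crosses \<open>1\<close> exactly when \<open>m\<close> crosses \<open>n powr (1 - 1 / s)\<close>.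
  
  Below the threshold: let \<open>\<beta>\<close> be a supercomponent with \<open>s\<close> inversions and consider the interval of
  positions spanned by an occurrence of \<open>\<beta>\<close>. Between two consecutive positions of this interval
  there is either an adjacency requirement (boundedly many) or an inversion that crosses the gap,
  because a component of \<open>\<beta>\<close> is indecomposable. Since a sequence has at least as many inversions as
  crossed gaps, the interval carries at least \<open>s\<close> inversions and nearly one inversion per position.
  Hence some window of bounded length has table sum at least \<open>s\<close>
  (\<open>contains_heavy_window\<close>). Removing units one at a time shows that this has probability
  \<open>O (n * (m / n) ^ s)\<close> (\<open>card_heavy_window\<close>).
  
  Above the threshold: if the inversion table of \<open>\<sigma>\<close> contains, from left to right in disjoint
  windows, the inversion tables of all supercomponents, then \<open>\<sigma>\<close> contains the pattern, since such a
  window is order isomorphic to the supercomponent and lies above everything to its left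
  (\<open>contains_direct_sums\<close>). Each supercomponent is looked for in its own segment of \<open>[n]\<close>, which is
  divided into blocks. That all blocks of a segment miss a word of sum \<open>t \<le> s\<close> is improbable by a
  switching argument (\<open>card_no_occurrence\<close>): take \<open>t\<close> units away anywhere, and use them to write the
  word into a block of zeros. There are about \<open>m ^ t * n\<close> ways to do this, up to constant factors,
  and \<open>O (n ^ t)\<close> ways to undo it, so the proportion of tables that miss the word is
  \<open>O ((n / m) ^ t / n)\<close>, which tends to \<open>0\<close>.
  
  The statement for nearly decreasing permutations follows by complementation, which turns \<open>m\<close>
  inversions into \<open>(n choose 2) - m\<close> and occurrences of \<open>\<pi>\<close> into occurrences of its complement.
\<close>

section \<open>Inversion tables\<close>

definition inv_table :: "nat list \<Rightarrow> nat \<Rightarrow> nat" where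
  "inv_table \<sigma> j = (if j < length \<sigma> then card {i. i < j \<and> \<sigma> ! i > \<sigma> ! j} else 0)"

definition inv_tables :: "nat \<Rightarrow> nat \<Rightarrow> (nat \<Rightarrow> nat) set" where
  "inv_tables n m = {e. (\<forall>i. e i \<le> i) \<and> (\<forall>i\<ge>n. e i = 0) \<and> sum e {..<n} = m}"

text \<open>
  Induction on the length. Once the first \<open>k\<close> terms are known to be ordered alike, the indices of
  the terms that exceed the last term form, in both sequences, a final segment of one and the same
  linear order; final segments of equal size coincide.
\<close>
lemma same_counts_same_order:
  fixes x y :: "nat \<Rightarrow> nat"
  assumes "inj_on x {..<k}" "inj_on y {..<k}"
    and "\<And>j. j < k \<Longrightarrow> card {i. i < j \<and> x i > x j} = card {i. i < j \<and> y i > y j}"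
  shows "\<forall>i<k. \<forall>j<k. x i < x j \<longleftrightarrow> y i < y j"
  using assms
proof (induction k)
  case (Suc k)
  have IH: "\<forall>i<k. \<forall>j<k. x i < x j \<longleftrightarrow> y i < y j"
    using Suc.prems by (intro Suc.IH) (auto intro: inj_on_subset)
  have dx: "x i \<noteq> x k" and dy: "y i \<noteq> y k" if "i < k" for i
    using that inj_onD[OF Suc.prems(1), of i k] inj_onD[OF Suc.prems(2), of i k] by auto
  let ?U = "{i. i < k \<and> x i > x k}" and ?V = "{i. i < k \<and> y i > y k}"
  have "?U = ?V"
  proof (rule ccontr)
    assume ne: "?U \<noteq> ?V"
    have c: "card ?U = card ?V" using Suc.prems(3)[of k] by simp
    have "\<not> ?U \<subseteq> ?V" using ne c card_subset_eq[of ?V ?U] by auto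
    then obtain i where i: "i < k" "x i > x k" "\<not> y i > y k" by auto
    have "\<not> ?V \<subseteq> ?U" using ne c card_subset_eq[of ?U ?V] by auto
    then obtain j where j: "j < k" "y j > y k" "\<not> x j > x k" by auto
    have "x j < x i" using i j by linarith
    moreover have "y i < y j" using i j by linarith
    ultimately show False using IH i j by (meson not_less_iff_gr_or_eq)
  qed
  then have *: "x i > x k \<longleftrightarrow> y i > y k" if "i < k" for i using that by blast
  then have **: "x i < x k \<longleftrightarrow> y i < y k" if "i < k" for i
    using that dx dy by (metis linorder_neqE_nat not_less_iff_gr_or_eq)
  show ?case using IH * ** by (auto simp: less_Suc_eq)
qed simp

lemma permutations_of_set_atLeast1D:
  assumes "\<sigma> \<in> permutations_of_set {1..n}"
  shows "length \<sigma> = n" "distinct \<sigma>" "set \<sigma> = {1..n}"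
  using assms by (auto simp: permutations_of_set_def distinct_card[symmetric])

lemma perm_nth_eq_card:
  assumes "\<sigma> \<in> permutations_of_set {1..n}" "i < n"
  shows "\<sigma> ! i = card {j. j < n \<and> \<sigma> ! j \<le> \<sigma> ! i}"
proof -
  note P = permutations_of_set_atLeast1D[OF assms(1)]
  have "(!) \<sigma> ` {j. j < n \<and> \<sigma> ! j \<le> \<sigma> ! i} = {1..\<sigma> ! i}"
  proof
    have "\<sigma> ! i \<le> n" using P assms(2) nth_mem[of i \<sigma>] by auto
    show "{1..\<sigma> ! i} \<subseteq> (!) \<sigma> ` {j. j < n \<and> \<sigma> ! j \<le> \<sigma> ! i}"
    proof
      fix v assume v: "v \<in> {1..\<sigma> ! i}"
      then have "v \<in> set \<sigma>" using P \<open>\<sigma> ! i \<le> n\<close> by auto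
      then obtain j where "j < n" "\<sigma> ! j = v" using P(1) by (metis in_set_conv_nth)
      then show "v \<in> (!) \<sigma> ` {j. j < n \<and> \<sigma> ! j \<le> \<sigma> ! i}" using v by auto
    qed
    show "(!) \<sigma> ` {j. j < n \<and> \<sigma> ! j \<le> \<sigma> ! i} \<subseteq> {1..\<sigma> ! i}"
    proof
      fix v assume "v \<in> (!) \<sigma> ` {j. j < n \<and> \<sigma> ! j \<le> \<sigma> ! i}"
      then obtain j where "j < n" "v = \<sigma> ! j" "v \<le> \<sigma> ! i" by auto
      then show "v \<in> {1..\<sigma> ! i}" using P(1,3) nth_mem[of j \<sigma>] by auto
    qed
  qed
  moreover have "inj_on ((!) \<sigma>) {j. j < n \<and> \<sigma> ! j \<le> \<sigma> ! i}"
    using P by (auto simp: inj_on_def nth_eq_iff_index_eq)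
  ultimately show ?thesis by (metis (no_types, lifting) card_image card_atLeastAtMost diff_Suc_1)
qed

lemma inj_on_inv_table: "inj_on inv_table (permutations_of_set {1..n})"
proof (rule inj_onI)
  fix \<sigma> \<tau> :: "nat list"
  assume s: "\<sigma> \<in> permutations_of_set {1..n}" and t: "\<tau> \<in> permutations_of_set {1..n}"
    and eq: "inv_table \<sigma> = inv_table \<tau>"
  note S = permutations_of_set_atLeast1D[OF s] and T = permutations_of_set_atLeast1D[OF t]
  have *: "\<forall>i<n. \<forall>j<n. \<sigma> ! i < \<sigma> ! j \<longleftrightarrow> \<tau> ! i < \<tau> ! j"
  proof (rule same_counts_same_order)
    show "card {i. i < j \<and> \<sigma> ! i > \<sigma> ! j} = card {i. i < j \<and> \<tau> ! i > \<tau> ! j}" if "j < n" for j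
      using fun_cong[OF eq, of j] that S T by (simp add: inv_table_def)
  qed (use S T in \<open>auto simp: inj_on_def nth_eq_iff_index_eq\<close>)
  have "\<sigma> ! i = \<tau> ! i" if "i < n" for i
  proof -
    have "{j. j < n \<and> \<sigma> ! j \<le> \<sigma> ! i} = {j. j < n \<and> \<tau> ! j \<le> \<tau> ! i}"
      using * that by (auto simp: not_less[symmetric])
    then show ?thesis using perm_nth_eq_card[OF s that] perm_nth_eq_card[OF t that] by simp
  qed
  then show "\<sigma> = \<tau>" using S T by (intro nth_equalityI) auto
qed

lemma inv_table_le: "inv_table \<sigma> j \<le> j"
proof -
  have "card {i. i < j \<and> \<sigma> ! i > \<sigma> ! j} \<le> card {..<j}" by (rule card_mono) auto
  then show ?thesis by (simp add: inv_table_def)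
qed

lemma sum_inv_table: "sum (inv_table \<sigma>) {..<length \<sigma>} = num_inversions \<sigma>"
proof -
  have "{(i, j). i < j \<and> j < length \<sigma> \<and> \<sigma> ! i > \<sigma> ! j}
      = prod.swap ` (SIGMA j:{..<length \<sigma>}. {i. i < j \<and> \<sigma> ! i > \<sigma> ! j})" (is "?L = prod.swap ` ?R")
  proof
    have "prod.swap (j, i) \<in> prod.swap ` ?R" if "(i, j) \<in> ?L" for i j
      using that by (intro imageI) simp
    then show "?L \<subseteq> prod.swap ` ?R" by (simp only: prod.swap_def fst_conv snd_conv) auto
  qed auto
  then have "num_inversions \<sigma> = card (prod.swap ` (SIGMA j:{..<length \<sigma>}. {i. i < j \<and> \<sigma> ! i > \<sigma> ! j}))"
    unfolding num_inversions_def by simp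
  also have "\<dots> = card (SIGMA j:{..<length \<sigma>}. {i. i < j \<and> \<sigma> ! i > \<sigma> ! j})"
    by (rule card_image) simp
  also have "\<dots> = sum (inv_table \<sigma>) {..<length \<sigma>}"
    by (subst card_SigmaI) (auto simp: inv_table_def)
  finally show ?thesis by simp
qed

text \<open>
  Surjectivity comes from counting: there are \<open>fact n\<close> sequences bounded by \<open>e i \<le> i\<close>, as many as
  permutations, and the encoding is injective.
\<close>
lemma bij_betw_inv_table:
  "bij_betw inv_table (perms_with_inversions n m) (inv_tables n m)"
proof -
  let ?T = "PiE_dflt {..<n} (0::nat) (\<lambda>i. {..i})"
  have sub: "inv_table ` permutations_of_set {1..n} \<subseteq> ?T"
  proof
    fix e assume "e \<in> inv_table ` permutations_of_set {1..n}"
    then obtain \<sigma> where "e = inv_table \<sigma>" "length \<sigma> = n"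
      using permutations_of_set_atLeast1D(1) by blast
    then show "e \<in> ?T" by (simp add: PiE_dflt_def inv_table_le) (simp add: inv_table_def)
  qed
  have "card ?T = (\<Prod>i<n. Suc i)" by (subst card_PiE_dflt) auto
  also have "\<dots> = fact n" by (induction n) (auto simp: mult.commute)
  finally have "card ?T = card (inv_table ` permutations_of_set {1..n})"
    using card_image[OF inj_on_inv_table[of n]] by (simp del: One_nat_def)
  moreover have "finite ?T" by (rule finite_PiE_dflt) auto
  ultimately have im: "inv_table ` permutations_of_set {1..n} = ?T"
    using sub by (metis card_subset_eq)
  have "inv_table ` perms_with_inversions n m = inv_tables n m"
  proof -
    have s: "num_inversions \<sigma> = sum (inv_table \<sigma>) {..<n}" if "\<sigma> \<in> permutations_of_set {1..n}" for \<sigma>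
      using sum_inv_table[of \<sigma>] permutations_of_set_atLeast1D[OF that] by simp
    have "inv_table ` perms_with_inversions n m = {e \<in> inv_table ` permutations_of_set {1..n}. sum e {..<n} = m}"
      by (auto simp: perms_with_inversions_def s)
    also have "\<dots> = inv_tables n m"
      unfolding im inv_tables_def PiE_dflt_def
      by (auto simp: not_less) (metis leI le_0_eq zero_le)
    finally show ?thesis .
  qed
  moreover have "inj_on inv_table (perms_with_inversions n m)"
    using inj_on_inv_table by (rule inj_on_subset) (auto simp: perms_with_inversions_def)
  ultimately show ?thesis by (simp add: bij_betw_def)
qed

lemma finite_inv_tables [simp]: "finite (inv_tables n m)"
  using bij_betw_finite[OF bij_betw_inv_table[of n m]] by (simp add: perms_with_inversions_def)

lemma inv_tables_nonempty: "m < n \<Longrightarrow> inv_tables n m \<noteq> {}"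
proof -
  assume "m < n"
  then have "(\<lambda>i. if i = n - 1 then m else 0) \<in> inv_tables n m"
    by (auto simp: inv_tables_def)
  then show ?thesis by blast
qed

lemma inv_tablesD:
  assumes "e \<in> inv_tables n m" shows "sum e {..<n} = m" "e i \<le> i" "i \<ge> n \<Longrightarrow> e i = 0"
  using assms by (auto simp: inv_tables_def)

lemma card_support_le:
  assumes "e \<in> inv_tables n m"
  shows "card {i. i < n \<and> e i > 0} \<le> m"
proof -
  have "card {i. i < n \<and> e i > 0} = (\<Sum>i\<in>{i. i < n \<and> e i > 0}. 1)" by simp
  also have "\<dots> \<le> (\<Sum>i\<in>{i. i < n \<and> e i > 0}. e i)" by (rule sum_mono) auto
  also have "\<dots> \<le> sum e {..<n}" by (rule sum_mono2) auto
  finally show ?thesis using assms by (simp add: inv_tables_def)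
qed

lemma sum_decrement:
  fixes e :: "nat \<Rightarrow> nat"
  assumes "finite I" "i \<in> I" "e i > 0"
  shows "sum (e(i := e i - 1)) I = sum e I - 1"
proof -
  have "sum (e(i := e i - 1)) I = (e i - 1) + sum e (I - {i})"
    using assms by (subst sum.remove[of I i]) auto
  moreover have "sum e I = e i + sum e (I - {i})" using assms by (subst sum.remove[of I i]) auto
  ultimately show ?thesis using assms by simp
qed

lemma sum_increment:
  fixes e :: "nat \<Rightarrow> nat"
  assumes "finite I" "i \<in> I"
  shows "sum (e(i := Suc (e i))) I = Suc (sum e I)"
proof -
  have "sum (e(i := Suc (e i))) I = Suc (e i) + sum e (I - {i})"
    using assms by (subst sum.remove[of I i]) auto
  moreover have "sum e I = e i + sum e (I - {i})" using assms by (subst sum.remove[of I i]) auto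
  ultimately show ?thesis using assms by simp
qed

lemma fun_upd_eqD:
  assumes "e(i := x) = e'(i := y)" "e i = e' i"
  shows "e = e'"
proof
  show "e j = e' j" for j using fun_cong[OF assms(1), of j] assms(2) by (cases "j = i") auto
qed

lemma inv_tables_decrement:
  assumes "e \<in> inv_tables n (Suc m)" "e i > 0"
  shows "e(i := e i - 1) \<in> inv_tables n m"
proof -
  have "i < n" using inv_tablesD(3)[OF assms(1), of i] assms(2) by (cases "i < n") simp_all
  then have "sum (e(i := e i - 1)) {..<n} = m"
    using assms by (subst sum_decrement) (auto simp: inv_tables_def)
  then show ?thesis using assms \<open>i < n\<close> by (auto simp: inv_tables_def intro: order.trans[OF diff_le_self])
qed

lemma inv_tables_increment:
  assumes "e \<in> inv_tables n m" "i < n" "e i < i"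
  shows "e(i := Suc (e i)) \<in> inv_tables n (Suc m)"
proof -
  have "sum (e(i := Suc (e i))) {..<n} = Suc m"
    using assms by (subst sum_increment) (auto simp: inv_tables_def)
  then show ?thesis using assms by (auto simp: inv_tables_def)
qed

lemma card_Sigma_ge:
  assumes "finite S" "\<And>x. x \<in> S \<Longrightarrow> finite (B x)" "\<And>x. x \<in> S \<Longrightarrow> c \<le> card (B x)"
  shows "card S * c \<le> card (SIGMA x:S. B x)"
  using sum_mono[of S "\<lambda>_. c" "\<lambda>x. card (B x)"] assms by (subst card_SigmaI) auto

lemma card_Sigma_le:
  assumes "finite S" "\<And>x. x \<in> S \<Longrightarrow> finite (B x)" "\<And>x. x \<in> S \<Longrightarrow> card (B x) \<le> c"
  shows "card (SIGMA x:S. B x) \<le> card S * c"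
  using sum_mono[of S "\<lambda>x. card (B x)" "\<lambda>_. c"] assms by (subst card_SigmaI) auto

section \<open>Counting inversion tables with a heavy window\<close>

text \<open>
  Double counting of the pairs of tables that differ by a single unit. A table of sum \<open>m\<close> can be
  incremented at every position where the bound \<open>e i \<le> i\<close> is not attained; it is attained at
  position \<open>0\<close> and otherwise only where \<open>e\<close> is positive, hence at most \<open>m + 1\<close> times.
\<close>
lemma card_inv_tables_ratio:
  "card (inv_tables n m) * (n - Suc m) \<le> card (inv_tables n (Suc m)) * Suc m"
proof -
  let ?F = "SIGMA e:inv_tables n m. {i. i < n \<and> e i < i}"
  let ?G = "SIGMA e:inv_tables n (Suc m). {i. i < n \<and> e i > 0}"
  have "n - Suc m \<le> card {i. i < n \<and> e i < i}" if e: "e \<in> inv_tables n m" for e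
  proof -
    \<comment> \<open>Where the bound is attained, either \<open>i = 0\<close> or \<open>e i = i > 0\<close>.\<close>
    have "{..<n} \<subseteq> {i. i < n \<and> e i < i} \<union> insert 0 {i. i < n \<and> e i > 0}"
      using inv_tablesD(2)[OF e] by (fastforce simp: not_less intro: gr0I le_antisym)
    then have "card {..<n} \<le> card ({i. i < n \<and> e i < i} \<union> insert 0 {i. i < n \<and> e i > 0})"
      by (rule card_mono[rotated]) auto
    also have "\<dots> \<le> card {i. i < n \<and> e i < i} + card (insert 0 {i. i < n \<and> e i > 0})"
      by (rule card_Un_le)
    also have "card (insert 0 {i. i < n \<and> e i > 0}) \<le> Suc m"
      using card_support_le[OF e] by (simp add: card_insert_if)
    finally show ?thesis by simp
  qed
  then have "card (inv_tables n m) * (n - Suc m) \<le> card ?F"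
    by (intro card_Sigma_ge) auto
  also have "card ?F \<le> card ?G"
  proof (rule card_inj_on_le)
    let ?f = "\<lambda>(e, i). (e(i := Suc (e i)), i) :: (nat \<Rightarrow> nat) \<times> nat"
    show "inj_on ?f ?F"
    proof (rule inj_onI, clarsimp)
      fix e e' :: "nat \<Rightarrow> nat" and i assume "e(i := Suc (e i)) = e'(i := Suc (e' i))"
      then show "e = e'" by (metis fun_upd_triv fun_upd_upd fun_upd_same nat.inject)
    qed
    show "?f ` ?F \<subseteq> ?G" by (auto simp: inv_tables_increment)
    show "finite ?G" by auto
  qed
  also have "card ?G \<le> card (inv_tables n (Suc m)) * Suc m"
    using card_support_le by (intro card_Sigma_le) auto
  finally show ?thesis .
qed

lemma card_inv_tables_ratio_power:
  assumes "s \<le> m"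
  shows "card (inv_tables n (m - s)) * (n - m) ^ s \<le> card (inv_tables n m) * m ^ s"
  using assms
proof (induction s)
  case (Suc s)
  define r where "r = m - Suc s"
  have r: "m - s = Suc r" using Suc.prems by (simp add: r_def)
  have "card (inv_tables n r) * (n - m) ^ Suc s = card (inv_tables n r) * (n - m) * (n - m) ^ s" by simp
  also have "\<dots> \<le> card (inv_tables n r) * (n - Suc r) * (n - m) ^ s"
    using r by (intro mult_le_mono) auto
  also have "\<dots> \<le> (card (inv_tables n (Suc r)) * Suc r) * (n - m) ^ s"
    using card_inv_tables_ratio[of n r] by (rule mult_le_mono1)
  also have "\<dots> \<le> (card (inv_tables n (Suc r)) * m) * (n - m) ^ s"
    using r by (intro mult_le_mono) auto
  also have "\<dots> = m * (card (inv_tables n (m - s)) * (n - m) ^ s)" by (simp add: r)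
  also have "\<dots> \<le> m * (card (inv_tables n m) * m ^ s)"
    using Suc by (intro mult_le_mono2) simp
  finally show ?case by (simp add: r_def algebra_simps)
qed simp

text \<open>
  Taking one unit out of the window, and remembering where, is injective.
\<close>
lemma card_heavy_window_step:
  "card {e \<in> inv_tables n (m + t). sum e {q..<q+K} \<ge> t} \<le> card (inv_tables n m) * K ^ t"
proof (induction t)
  case 0
  show ?case by simp
next
  case (Suc t)
  let ?H = "\<lambda>t. {e \<in> inv_tables n (m + t). sum e {q..<q+K} \<ge> t}"
  define p where "p = (\<lambda>e. SOME i. i \<in> {q..<q+K} \<and> e i > (0::nat))"
  have p: "p e \<in> {q..<q+K} \<and> e (p e) > 0" if "e \<in> ?H (Suc t)" for e
    unfolding p_def
  proof (rule someI_ex)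
    show "\<exists>i. i \<in> {q..<q+K} \<and> e i > 0"
    proof (rule ccontr)
      assume "\<not> ?thesis"
      then have "sum e {q..<q+K} = 0" by (intro sum.neutral) auto
      then show False using that by auto
    qed
  qed
  have "card (?H (Suc t)) \<le> card (?H t \<times> {q..<q+K})"
  proof (rule card_inj_on_le)
    let ?f = "\<lambda>e. (e(p e := e (p e) - 1), p e)"
    show "inj_on ?f (?H (Suc t))"
    proof (rule inj_onI)
      fix e e' assume e: "e \<in> ?H (Suc t)" and e': "e' \<in> ?H (Suc t)" and "?f e = ?f e'"
      then have eq: "p e = p e'" "e(p e := e (p e) - 1) = e'(p e := e' (p e) - 1)" by auto
      have "e (p e) > 0" "e' (p e) > 0" using p[OF e] p[OF e'] eq(1) by auto
      then have "e (p e) = e' (p e)" using fun_cong[OF eq(2), of "p e"] by simp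
      then show "e = e'" by (rule fun_upd_eqD[OF eq(2)])
    qed
    show "?f ` ?H (Suc t) \<subseteq> ?H t \<times> {q..<q+K}"
    proof
      fix z assume "z \<in> ?f ` ?H (Suc t)"
      then obtain e where e: "e \<in> ?H (Suc t)" and z: "z = ?f e" by auto
      have "sum (e(p e := e (p e) - 1)) {q..<q+K} \<ge> t"
        using e p[OF e] sum_decrement[of "{q..<q+K}" "p e" e] by (auto simp del: fun_upd_apply)
      moreover have "e(p e := e (p e) - 1) \<in> inv_tables n (m + t)"
        using e p[OF e] by (intro inv_tables_decrement) auto
      ultimately show "z \<in> ?H t \<times> {q..<q+K}" using p[OF e] z by auto
    qed
  qed auto
  also have "\<dots> = card (?H t) * K" by (simp add: card_cartesian_product)
  also have "\<dots> \<le> card (inv_tables n m) * K ^ t * K" using Suc by (rule mult_le_mono1)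
  finally show ?case by (simp add: mult_ac)
qed

text \<open>
  The union bound over the position of the window. A window that starts at \<open>n\<close> or later is empty of
  units, which is why \<open>n\<close> starting points suffice although \<open>q\<close> is unrestricted.
\<close>
lemma card_heavy_window:
  assumes "s > 0"
  shows "card {e \<in> inv_tables n m. \<exists>q. sum e {q..<q+K} \<ge> s} * (n - m) ^ s
         \<le> n * (K * m) ^ s * card (inv_tables n m)"
proof (cases "s \<le> m")
  case True
  let ?H = "\<lambda>q. {e \<in> inv_tables n (m - s + s). sum e {q..<q+K} \<ge> s}"
  have "{e \<in> inv_tables n m. \<exists>q. sum e {q..<q+K} \<ge> s} \<subseteq> (\<Union>q<n. ?H q)"
  proof
    fix e assume "e \<in> {e \<in> inv_tables n m. \<exists>q. sum e {q..<q+K} \<ge> s}"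
    then obtain q where e: "e \<in> inv_tables n m" "s \<le> sum e {q..<q+K}" by auto
    have "q < n"
    proof (rule ccontr)
      assume "\<not> q < n"
      then have "sum e {q..<q+K} = 0" using e by (intro sum.neutral) (auto simp: inv_tables_def)
      then show False using e assms by simp
    qed
    then show "e \<in> (\<Union>q<n. ?H q)" using e True by auto
  qed
  then have "card {e \<in> inv_tables n m. \<exists>q. sum e {q..<q+K} \<ge> s} \<le> card (\<Union>q<n. ?H q)"
    by (rule card_mono[rotated]) auto
  also have "\<dots> \<le> (\<Sum>q<n. card (?H q))" by (rule card_UN_le) auto
  also have "\<dots> \<le> (\<Sum>q<n. card (inv_tables n (m - s)) * K ^ s)"
    by (rule sum_mono) (rule card_heavy_window_step)
  finally have "card {e \<in> inv_tables n m. \<exists>q. sum e {q..<q+K} \<ge> s} \<le> n * K ^ s * card (inv_tables n (m - s))"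
    by (simp add: mult_ac)
  then have "card {e \<in> inv_tables n m. \<exists>q. sum e {q..<q+K} \<ge> s} * (n - m) ^ s
      \<le> n * K ^ s * (card (inv_tables n (m - s)) * (n - m) ^ s)"
    by (subst mult.assoc[symmetric]) (rule mult_le_mono1)
  also have "\<dots> \<le> n * K ^ s * (card (inv_tables n m) * m ^ s)"
    by (rule mult_le_mono2) (rule card_inv_tables_ratio_power[OF True])
  finally show ?thesis by (simp add: mult_ac power_mult_distrib)
next
  case False
  have "sum e {q..<q+K} \<le> m" if "e \<in> inv_tables n m" for e q
  proof -
    have "sum e {q..<q+K} = sum e ({q..<q+K} \<inter> {..<n})"
    proof (intro sum.mono_neutral_right ballI)
      fix i assume "i \<in> {q..<q+K} - {q..<q+K} \<inter> {..<n}"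
      then show "e i = 0" using inv_tablesD(3)[OF that, of i] by (auto simp: not_less)
    qed auto
    also have "\<dots> \<le> sum e {..<n}" by (rule sum_mono2) auto
    finally show ?thesis using that by (simp add: inv_tables_def)
  qed
  then have "{e \<in> inv_tables n m. \<exists>q. sum e {q..<q+K} \<ge> s} = {}"
    using False by (auto simp: not_le intro: le_less_trans)
  then show ?thesis by (simp only: card.empty mult_zero_left le0)
qed

section \<open>Counting inversion tables that avoid a word\<close>

text \<open>
  The blocks \<open>u \<in> B\<close> whose first \<open>l\<close> entries spell the word \<open>w\<close>, where block \<open>u\<close> starts at position
  \<open>u * k\<close>. With \<open>l \<le> k\<close> the blocks are disjoint, so a change of one entry affects only one of them.
\<close>
definition occurrences :: "nat \<Rightarrow> nat set \<Rightarrow> nat \<Rightarrow> (nat \<Rightarrow> nat) \<Rightarrow> (nat \<Rightarrow> nat) \<Rightarrow> nat set" where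
  "occurrences k B l w e = {u \<in> B. \<forall>i<l. e (u * k + i) = w i}"

lemma block_index_unique:
  fixes u v k i j :: nat
  assumes "u * k + i = v * k + j" "i < k" "j < k"
  shows "u = v"
proof -
  have "(u * k + i) div k = u" "(v * k + j) div k = v" using assms(2,3) by auto
  then show ?thesis using assms(1) by simp
qed

lemma card_occurrences_decrement_le:
  assumes "finite B" "l \<le> k"
  shows "card (occurrences k B l w (e(j := x))) \<le> Suc (card (occurrences k B l w e))"
proof -
  have "occurrences k B l w (e(j := x)) \<subseteq> insert (j div k) (occurrences k B l w e)"
  proof
    fix u assume u: "u \<in> occurrences k B l w (e(j := x))"
    show "u \<in> insert (j div k) (occurrences k B l w e)"
    proof (cases "u = j div k")
      case False
      have "u * k + i \<noteq> j" if "i < l" for i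
      proof
        assume "u * k + i = j"
        moreover have "(u * k + i) div k = u" using that assms by auto
        ultimately show False using False by simp
      qed
      then show ?thesis using u by (auto simp: occurrences_def)
    qed simp
  qed
  then have "card (occurrences k B l w (e(j := x))) \<le> card (insert (j div k) (occurrences k B l w e))"
    using assms by (intro card_mono) (auto simp: occurrences_def)
  also have "\<dots> \<le> Suc (card (occurrences k B l w e))"
    using assms by (simp add: card_insert_if occurrences_def)
  finally show ?thesis .
qed

definition few_occurrences where
  "few_occurrences n m k B l w c = {e \<in> inv_tables n m. card (occurrences k B l w e) \<le> c}"

lemma finite_few_occurrences [simp]: "finite (few_occurrences n m k B l w c)"
  by (simp add: few_occurrences_def)

text \<open>
  Removing one unit, for the first half of the switching. The units of a table are treated as
  distinguishable: a triple \<open>(e, i, x)\<close> with \<open>x < e i\<close> marks a unit of \<open>e\<close>, and after its removal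
  \<open>x\<close> is one of \<open>Suc (e i)\<close> possible marks. This weighting makes the number of forward moves exactly
  the sum of the table, however unevenly the units are spread.
\<close>
lemma card_few_occurrences_step:
  assumes "finite B" "l \<le> k"
  shows "card (few_occurrences n (Suc m) k B l w c) * Suc m
       \<le> card (few_occurrences n m k B l w (Suc c)) * (n + m)"
proof -
  let ?U = "few_occurrences n (Suc m) k B l w c" and ?V = "few_occurrences n m k B l w (Suc c)"
  let ?F = "SIGMA e:?U. SIGMA i:{..<n}. {..<e i}"
  let ?G = "SIGMA e:?V. SIGMA i:{..<n}. {..<Suc (e i)}"
  have "card ?U * Suc m \<le> card ?F"
  proof (rule card_Sigma_ge)
    show "Suc m \<le> card (SIGMA i:{..<n}. {..<e i})" if "e \<in> ?U" for e
      using that by (simp add: few_occurrences_def inv_tables_def)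
  qed simp_all
  also have "card ?F \<le> card ?G"
  proof (rule card_inj_on_le)
    let ?f = "\<lambda>(e, i, x). (e(i := e i - 1), i, x) :: (nat \<Rightarrow> nat) \<times> nat \<times> nat"
    show "inj_on ?f ?F"
    proof (rule inj_onI)
      fix a b assume a: "a \<in> ?F" and b: "b \<in> ?F" and eq: "?f a = ?f b"
      obtain e i x where A: "a = (e, i, x)" by (cases a)
      obtain e' i' x' where B: "b = (e', i', x')" by (cases b)
      have *: "i' = i" "x' = x" "e(i := e i - 1) = e'(i := e' i - 1)" using eq A B by auto
      have "e i > 0" "e' i > 0" using a b A B * by auto
      then have "e i = e' i" using fun_cong[OF *(3), of i] by simp
      then have "e = e'" by (rule fun_upd_eqD[OF *(3)])
      then show "a = b" using A B * by simp
    qed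
    show "?f ` ?F \<subseteq> ?G"
    proof
      fix z assume "z \<in> ?f ` ?F"
      then obtain e i x where z: "z = (e(i := e i - 1), i, x)" and e: "e \<in> ?U" "i < n" "x < e i" by auto
      have "e(i := e i - 1) \<in> inv_tables n m"
        using e by (intro inv_tables_decrement) (auto simp: few_occurrences_def)
      moreover have "card (occurrences k B l w (e(i := e i - 1))) \<le> Suc c"
        using card_occurrences_decrement_le[OF assms, of w e i "e i - 1"] e by (simp add: few_occurrences_def)
      ultimately show "z \<in> ?G" using z e by (auto simp: few_occurrences_def)
    qed
    show "finite ?G" by auto
  qed
  also have "card ?G \<le> card ?V * (n + m)"
  proof (rule card_Sigma_le)
    show "card (SIGMA i:{..<n}. {..<Suc (e i)}) \<le> n + m" if "e \<in> ?V" for e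
      using that by (simp add: few_occurrences_def inv_tables_def sum_Suc)
  qed simp_all
  finally show ?thesis .
qed

lemma card_few_occurrences_remove:
  assumes "finite B" "l \<le> k" "t \<le> m"
  shows "card (few_occurrences n m k B l w 0) * (m - t) ^ t
       \<le> card (few_occurrences n (m - t) k B l w t) * (n + m) ^ t"
  using assms(3)
proof (induction t)
  case (Suc t)
  let ?U = "\<lambda>t. card (few_occurrences n (m - t) k B l w t)"
  define r where "r = m - Suc t"
  have r: "m - t = Suc r" using Suc.prems by (simp add: r_def)
  have "?U 0 * r ^ t \<le> ?U 0 * (m - t) ^ t"
    by (intro mult_le_mono2 power_mono) (auto simp: r_def)
  also have "\<dots> \<le> ?U t * (n + m) ^ t" using Suc by simp
  finally have "?U 0 * r ^ t * r \<le> ?U t * (n + m) ^ t * Suc r" by (rule mult_le_mono) simp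
  also have "\<dots> = (?U t * Suc r) * (n + m) ^ t" by (simp only: mult_ac)
  also have "\<dots> \<le> (?U (Suc t) * (n + r)) * (n + m) ^ t"
    using card_few_occurrences_step[OF assms(1,2), of n r w t] r
    by (intro mult_le_mono1) (simp only: r_def)
  also have "\<dots> \<le> (?U (Suc t) * (n + m)) * (n + m) ^ t"
    by (intro mult_le_mono1 mult_le_mono2) (auto simp: r_def)
  finally show ?case by (simp add: r_def mult_ac)
qed simp

definition put_word :: "nat \<Rightarrow> nat \<Rightarrow> (nat \<Rightarrow> nat) \<Rightarrow> nat \<Rightarrow> (nat \<Rightarrow> nat) \<Rightarrow> nat \<Rightarrow> nat" where
  "put_word k l w u e x = (if u * k \<le> x \<and> x < u * k + l then w (x - u * k) else e x)"

lemma put_word_block: "i < l \<Longrightarrow> put_word k l w u e (u * k + i) = w i"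
  by (simp add: put_word_def)

lemma sum_split_block:
  fixes e :: "nat \<Rightarrow> nat"
  assumes "p + l \<le> n"
  shows "sum e {..<n} = (\<Sum>i<l. e (p + i)) + sum e ({..<n} - {p..<p+l})"
proof -
  have "sum e {..<n} = sum e {p..<p+l} + sum e ({..<n} - {p..<p+l})"
    using assms by (intro sum.subset_diff[THEN trans, OF _ _ add.commute]) auto
  also have "sum e {p..<p+l} = (\<Sum>i<l. e (p + i))"
    using sum.shift_bounds_nat_ivl[of e 0 p l] by (simp add: atLeast0LessThan add.commute)
  finally show ?thesis .
qed

lemma put_word_in_inv_tables:
  assumes "e \<in> inv_tables n m" "\<forall>i<l. e (u * k + i) = 0" "u * k + l \<le> n" "\<And>i. i < l \<Longrightarrow> w i \<le> i"
  shows "put_word k l w u e \<in> inv_tables n (m + sum w {..<l})"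
proof -
  have "sum (put_word k l w u e) {..<n} = sum w {..<l} + sum (put_word k l w u e) ({..<n} - {u*k..<u*k+l})"
    by (subst sum_split_block[OF assms(3)]) (simp add: put_word_block)
  also have "sum (put_word k l w u e) ({..<n} - {u*k..<u*k+l}) = sum e ({..<n} - {u*k..<u*k+l})"
    by (rule sum.cong) (auto simp: put_word_def)
  also have "\<dots> = m"
    using sum_split_block[OF assms(3), of e] assms(1,2) by (simp add: inv_tables_def)
  finally have "sum (put_word k l w u e) {..<n} = m + sum w {..<l}" by simp
  moreover have "put_word k l w u e x \<le> x" for x
    using assms(4)[of "x - u*k"] inv_tablesD(2)[OF assms(1), of x]
    by (auto simp: put_word_def intro: order.trans[of _ "x - u * k"])
  ultimately show ?thesis using assms(1,3) by (auto simp: inv_tables_def put_word_def)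
qed

text \<open>
  Each block that is not identically zero uses up at least one of the \<open>m\<close> units.
\<close>
lemma card_zero_blocks:
  assumes "finite B" "l \<le> k" "e \<in> inv_tables n m"
  shows "card B - m \<le> card {u \<in> B. \<forall>i<l. e (u * k + i) = 0}"
proof -
  let ?Z = "{u \<in> B. \<forall>i<l. e (u * k + i) = 0}"
  have "B - ?Z \<subseteq> (\<lambda>x. x div k) ` {i. i < n \<and> e i > 0}"
  proof
    fix u assume "u \<in> B - ?Z"
    then obtain i where i: "i < l" "e (u * k + i) > 0" by auto
    then have "u * k + i < n" using inv_tablesD(3)[OF assms(3)] by (metis leI less_irrefl)
    moreover have "(u * k + i) div k = u" using i assms by auto
    ultimately show "u \<in> (\<lambda>x. x div k) ` {i. i < n \<and> e i > 0}"
      using i by (intro image_eqI[of _ _ "u * k + i"]) auto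
  qed
  then have "card (B - ?Z) \<le> card ((\<lambda>x. x div k) ` {i. i < n \<and> e i > 0})"
    by (rule card_mono[rotated]) auto
  also have "\<dots> \<le> card {i. i < n \<and> e i > 0}" by (rule card_image_le) auto
  also have "\<dots> \<le> m" by (rule card_support_le[OF assms(3)])
  finally have "card (B - ?Z) \<le> m" .
  moreover have "card (B - ?Z) = card B - card ?Z"
    using assms(1) by (intro card_Diff_subset) auto
  ultimately show ?thesis by simp
qed

text \<open>
  The second half of the switching. The word is written into a block of zeros; conversely it can be
  erased from any of the blocks where it occurs, of which there are at most \<open>Suc c\<close>.
\<close>
lemma card_few_occurrences_insert:
  assumes "finite B" "l \<le> k" "\<And>u. u \<in> B \<Longrightarrow> u * k + l \<le> n" "\<And>i. i < l \<Longrightarrow> w i \<le> i"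
  shows "card (few_occurrences n m k B l w c) * (card B - m)
       \<le> card (inv_tables n (m + sum w {..<l})) * Suc c"
proof -
  let ?U = "few_occurrences n m k B l w c"
  let ?E = "{e \<in> inv_tables n (m + sum w {..<l}). card (occurrences k B l w e) \<le> Suc c}"
  let ?F = "SIGMA e:?U. {u \<in> B. \<forall>i<l. e (u * k + i) = 0}"
  let ?G = "SIGMA e:?E. occurrences k B l w e"
  have "card ?U * (card B - m) \<le> card ?F"
    using assms(1) by (intro card_Sigma_ge) (auto intro!: card_zero_blocks[OF assms(1,2)] simp: few_occurrences_def)
  also have "card ?F \<le> card ?G"
  proof (rule card_inj_on_le)
    let ?f = "\<lambda>(e, u). (put_word k l w u e, u)"
    show "inj_on ?f ?F"
    proof (rule inj_onI)
      fix a b assume a: "a \<in> ?F" and b: "b \<in> ?F" and eq: "?f a = ?f b"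
      obtain e u where A: "a = (e, u)" by (cases a)
      obtain e' u' where B: "b = (e', u')" by (cases b)
      have *: "u' = u" "put_word k l w u e = put_word k l w u e'" using eq A B by auto
      have "e x = e' x" for x
      proof (cases "u * k \<le> x \<and> x < u * k + l")
        case True
        have "\<forall>i<l. e (u * k + i) = 0" "\<forall>i<l. e' (u * k + i) = 0" using a b A B * by auto
        then have "e (u * k + (x - u * k)) = e' (u * k + (x - u * k))"
          using True by (metis add_diff_inverse_nat add_less_cancel_left not_less)
        then show ?thesis using True by simp
      next
        case False
        then show ?thesis using fun_cong[OF *(2), of x] by (simp add: put_word_def split: if_splits)
      qed
      then show "a = b" using A B * by auto
    qed
    show "?f ` ?F \<subseteq> ?G"
    proof
      fix z assume "z \<in> ?f ` ?F"
      then obtain e u where z: "z = (put_word k l w u e, u)" and e: "e \<in> ?U" "u \<in> B"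
        "\<forall>i<l. e (u * k + i) = 0" by auto
      have "put_word k l w u e \<in> inv_tables n (m + sum w {..<l})"
        using e assms by (intro put_word_in_inv_tables) (auto simp: few_occurrences_def)
      moreover have "u \<in> occurrences k B l w (put_word k l w u e)"
        using e by (simp add: occurrences_def put_word_block)
      moreover have "occurrences k B l w (put_word k l w u e) \<subseteq> insert u (occurrences k B l w e)"
      proof
        fix v assume v: "v \<in> occurrences k B l w (put_word k l w u e)"
        show "v \<in> insert u (occurrences k B l w e)"
        proof (cases "v = u")
          case False
          have "e (v * k + i) = put_word k l w u e (v * k + i)" if "i < l" for i
          proof -
            have "\<not> (u * k \<le> v * k + i \<and> v * k + i < u * k + l)"
            proof
              assume *: "u * k \<le> v * k + i \<and> v * k + i < u * k + l"
              then have "v * k + i = u * k + (v * k + i - u * k)" by simp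
              then show False
                using block_index_unique[of v k i u "v * k + i - u * k"] * that assms(2) False by linarith
            qed
            then show ?thesis by (auto simp: put_word_def)
          qed
          then show ?thesis using v by (auto simp: occurrences_def)
        qed simp
      qed
      then have "card (occurrences k B l w (put_word k l w u e)) \<le> card (insert u (occurrences k B l w e))"
        using assms(1) by (intro card_mono) (auto simp: occurrences_def)
      then have "card (occurrences k B l w (put_word k l w u e)) \<le> Suc c"
        using e assms(1) by (simp add: card_insert_if few_occurrences_def occurrences_def split: if_splits)
      ultimately show "z \<in> ?G" using z by auto
    qed
    show "finite ?G" using assms(1) by (auto simp: occurrences_def)
  qed
  also have "card ?G \<le> card ?E * Suc c"
    using assms(1) by (intro card_Sigma_le) (auto simp: occurrences_def)
  also have "\<dots> \<le> card (inv_tables n (m + sum w {..<l})) * Suc c"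
    by (intro mult_le_mono1 card_mono) auto
  finally show ?thesis .
qed

text \<open>
  The two halves of the switching combined: removing \<open>t\<close> units creates at most \<open>t\<close> occurrences of
  the word, and inserting the word gives back a table of the original sum.
\<close>
lemma card_no_occurrence:
  assumes "finite B" "l \<le> k" "\<And>u. u \<in> B \<Longrightarrow> u * k + l \<le> n" "\<And>i. i < l \<Longrightarrow> w i \<le> i"
    and t: "t = sum w {..<l}" "t \<le> m"
  shows "card {e \<in> inv_tables n m. occurrences k B l w e = {}} * (m - t) ^ t * (card B - m)
       \<le> card (inv_tables n m) * Suc t * (n + m) ^ t"
proof -
  have "{e \<in> inv_tables n m. occurrences k B l w e = {}} = few_occurrences n m k B l w 0"
    using assms(1) by (auto simp: few_occurrences_def occurrences_def)
  then have "card {e \<in> inv_tables n m. occurrences k B l w e = {}} * (m - t) ^ t * (card B - m)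
      \<le> card (few_occurrences n (m - t) k B l w t) * (n + m) ^ t * (card B - m)"
    using card_few_occurrences_remove[OF assms(1,2) t(2), of n w] by (simp add: mult_le_mono1)
  also have "\<dots> \<le> (card (few_occurrences n (m - t) k B l w t) * (card B - (m - t))) * (n + m) ^ t"
    by (subst (2) mult.commute, subst mult.assoc[symmetric], intro mult_le_mono1) (simp add: mult.commute diff_le_mono2)
  also have "\<dots> \<le> (card (inv_tables n m) * Suc t) * (n + m) ^ t"
    using card_few_occurrences_insert[OF assms(1-4), of "m - t" t] t by (intro mult_le_mono1) simp
  finally show ?thesis .
qed

section \<open>Direct sums and their occurrences\<close>

text \<open>
  A window of the inversion table of \<open>\<sigma>\<close> that equals the inversion table of \<open>\<beta>\<close> has entry at most
  \<open>i\<close> at its \<open>i\<close>th place. By induction every term of the window exceeds everything before the window: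
  a term below some earlier \<open>\<sigma> ! q\<close> would be exceeded by \<open>q\<close> and by all \<open>i\<close> preceding terms of the
  window. So all inversions counted in the window lie inside it, and the window is ordered as \<open>\<beta>\<close>.
\<close>
lemma window_order:
  assumes "distinct \<sigma>" "p + k \<le> length \<sigma>" "distinct \<beta>" "length \<beta> = k"
    and tab: "\<And>i. i < k \<Longrightarrow> inv_table \<sigma> (p + i) = inv_table \<beta> i"
  shows "i < k \<Longrightarrow> q < p \<Longrightarrow> \<sigma> ! q < \<sigma> ! (p + i)"
    and "i < k \<Longrightarrow> j < k \<Longrightarrow> \<sigma> ! (p + i) < \<sigma> ! (p + j) \<longleftrightarrow> \<beta> ! i < \<beta> ! j"
proof -
  have dom: "\<sigma> ! q < \<sigma> ! (p + i)" if "i < k" "q < p" for i q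
    using that
  proof (induction i rule: less_induct)
    case (less i)
    show ?case
    proof (rule ccontr)
      assume "\<not> \<sigma> ! q < \<sigma> ! (p + i)"
      moreover have "\<sigma> ! q \<noteq> \<sigma> ! (p + i)"
        using assms(1,2) less.prems by (simp add: nth_eq_iff_index_eq)
      ultimately have gt: "\<sigma> ! (p + i) < \<sigma> ! q" by simp
      \<comment> \<open>These are \<open>Suc i\<close> earlier terms that exceed the term at \<open>p + i\<close>, one too many.\<close>
    have "insert q ((+) p ` {..<i}) \<subseteq> {x. x < p + i \<and> \<sigma> ! x > \<sigma> ! (p + i)}"
      proof -
        have "\<sigma> ! (p + x) > \<sigma> ! (p + i)" if "x < i" for x
          using less.IH[of x] that less.prems gt by force
        then show ?thesis using gt less.prems by auto
      qed
      then have "card (insert q ((+) p ` {..<i})) \<le> card {x. x < p + i \<and> \<sigma> ! x > \<sigma> ! (p + i)}"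
        by (rule card_mono[rotated]) auto
      also have "\<dots> = inv_table \<beta> i"
        using tab[of i] less.prems assms(2) by (simp add: inv_table_def)
      also have "\<dots> \<le> i" by (rule inv_table_le)
      finally have "card (insert q ((+) p ` {..<i})) \<le> i" .
      moreover have "q \<notin> (+) p ` {..<i}" using less.prems by auto
      ultimately show False by (simp add: card_image)
    qed
  qed
  show "\<sigma> ! q < \<sigma> ! (p + i)" if "i < k" "q < p" using dom that .
  have "\<forall>i<k. \<forall>j<k. \<sigma> ! (p + i) < \<sigma> ! (p + j) \<longleftrightarrow> \<beta> ! i < \<beta> ! j"
  proof (rule same_counts_same_order)
    fix j assume j: "j < k"
    have "{x. x < p + j \<and> \<sigma> ! x > \<sigma> ! (p + j)} = (+) p ` {i. i < j \<and> \<sigma> ! (p + i) > \<sigma> ! (p + j)}"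
    proof
      show "{x. x < p + j \<and> \<sigma> ! x > \<sigma> ! (p + j)} \<subseteq> (+) p ` {i. i < j \<and> \<sigma> ! (p + i) > \<sigma> ! (p + j)}"
      proof
        fix x assume x: "x \<in> {x. x < p + j \<and> \<sigma> ! x > \<sigma> ! (p + j)}"
        then have "p \<le> x" using dom[OF j, of x] by (cases "x < p") auto
        then show "x \<in> (+) p ` {i. i < j \<and> \<sigma> ! (p + i) > \<sigma> ! (p + j)}"
          using x by (intro image_eqI[of _ _ "x - p"]) auto
      qed
    qed auto
    then have "card {i. i < j \<and> \<sigma> ! (p + i) > \<sigma> ! (p + j)} = inv_table \<sigma> (p + j)"
      using assms(2) j by (simp add: inv_table_def card_image)
    then show "card {i. i < j \<and> \<sigma> ! (p + i) > \<sigma> ! (p + j)} = card {i. i < j \<and> \<beta> ! i > \<beta> ! j}"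
      using tab[OF j] assms(4) j by (simp add: inv_table_def)
  qed (use assms in \<open>auto simp: inj_on_def nth_eq_iff_index_eq\<close>)
  then show "\<sigma> ! (p + i) < \<sigma> ! (p + j) \<longleftrightarrow> \<beta> ! i < \<beta> ! j" if "i < k" "j < k" using that by blast
qed

definition offset :: "nat list list \<Rightarrow> nat \<Rightarrow> nat" where
  "offset \<beta>s j = sum_list (map length (take j \<beta>s))"

lemma offset_0 [simp]: "offset \<beta>s 0 = 0" by (simp add: offset_def)

lemma offset_Suc: "j < length \<beta>s \<Longrightarrow> offset \<beta>s (Suc j) = offset \<beta>s j + length (\<beta>s ! j)"
  by (simp add: offset_def take_Suc_conv_app_nth)

lemma offset_mono: "i \<le> j \<Longrightarrow> offset \<beta>s i \<le> offset \<beta>s j"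
  by (auto simp: offset_def take_add dest!: le_Suc_ex)

lemma offset_less: "i < j \<Longrightarrow> i < length \<beta>s \<Longrightarrow> offset \<beta>s i + length (\<beta>s ! i) \<le> offset \<beta>s j"
  using offset_mono[of "Suc i" j \<beta>s] by (simp add: offset_Suc)

lemma length_direct_sum [simp]: "length (\<sigma> \<oplus> \<tau>) = length \<sigma> + length \<tau>"
  by (simp add: direct_sum_def)

lemma length_direct_sums: "length (direct_sums \<beta>s) = offset \<beta>s (length \<beta>s)"
proof -
  have "length (direct_sums \<beta>s) = sum_list (map length \<beta>s)" by (induction \<beta>s) auto
  then show ?thesis by (simp add: offset_def)
qed

lemma direct_sum_assoc: "(\<sigma> \<oplus> \<tau>) \<oplus> \<rho> = \<sigma> \<oplus> \<tau> \<oplus> \<rho>"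
  by (simp add: direct_sum_def o_def add.assoc)

lemma direct_sum_Nil [simp]: "[] \<oplus> \<sigma> = \<sigma>"
  by (simp add: direct_sum_def)

lemma direct_sums_append: "direct_sums (xs @ ys) = direct_sums xs \<oplus> direct_sums ys"
  by (induction xs) (simp_all add: direct_sum_assoc)

lemma is_perm_direct_sum:
  assumes "is_perm \<sigma>" "is_perm \<tau>" shows "is_perm (\<sigma> \<oplus> \<tau>)"
proof -
  have "set (\<sigma> \<oplus> \<tau>) = {1..length \<sigma>} \<union> (\<lambda>x. length \<sigma> + x) ` {1..length \<tau>}"
    using assms by (simp add: is_perm_iff direct_sum_def)
  also have "\<dots> = {1..length \<sigma> + length \<tau>}"
    by (auto simp: image_iff Bex_def)
  finally show ?thesis by (simp add: is_perm_iff)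
qed

lemma is_perm_direct_sums: "\<forall>\<beta>\<in>set \<beta>s. is_perm \<beta> \<Longrightarrow> is_perm (direct_sums \<beta>s)"
  by (induction \<beta>s) (auto simp: is_perm_direct_sum, simp add: is_perm_iff)

lemma direct_sums_nth:
  assumes "j < length \<beta>s" "i < length (\<beta>s ! j)"
  shows "direct_sums \<beta>s ! (offset \<beta>s j + i) = offset \<beta>s j + \<beta>s ! j ! i"
proof -
  have "direct_sums \<beta>s = direct_sums (take j \<beta>s) \<oplus> \<beta>s ! j \<oplus> direct_sums (drop (Suc j) \<beta>s)"
    using id_take_nth_drop[OF assms(1)] by (metis direct_sums_append direct_sums_simps(2))
  moreover have "length (direct_sums (take j \<beta>s)) = offset \<beta>s j"
    using assms by (simp add: length_direct_sums offset_def)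
  ultimately show ?thesis using assms(2) by (simp add: direct_sum_def nth_append)
qed

lemma offset_locate:
  "t < offset \<beta>s l \<Longrightarrow> l \<le> length \<beta>s \<Longrightarrow> \<exists>j<l. \<exists>i<length (\<beta>s ! j). t = offset \<beta>s j + i"
proof (induction l)
  case (Suc l)
  show ?case
  proof (cases "t < offset \<beta>s l")
    case True
    then obtain j i where "j < l" "i < length (\<beta>s ! j)" "t = offset \<beta>s j + i" using Suc by auto
    then show ?thesis by (intro exI[of _ j]) auto
  next
    case False
    then show ?thesis using Suc.prems by (intro exI[of _ l] conjI exI[of _ "t - offset \<beta>s l"]) (auto simp: offset_Suc)
  qed
qed simp

text \<open>
  The occurrence maps position \<open>t\<close> of the pattern, which is the \<open>I t\<close>th place of the summand number
  \<open>J t\<close>, to the \<open>I t\<close>th place of the window assigned to this summand. Positions inside one summand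
  stay consecutive, and adjacency is never required across two summands.
\<close>
lemma contains_direct_sums:
  assumes "distinct \<sigma>" and \<pi>: "\<pi> = direct_sums \<beta>s" and perm: "\<And>\<beta>. \<beta> \<in> set \<beta>s \<Longrightarrow> is_perm \<beta>"
    and A: "A \<subseteq> {1..length \<pi> - 1}" "\<And>j. 0 < j \<Longrightarrow> j < length \<beta>s \<Longrightarrow> offset \<beta>s j \<notin> A"
    and p: "\<And>j. j < length \<beta>s \<Longrightarrow> p j + length (\<beta>s ! j) \<le> length \<sigma>"
      "\<And>i j. i < j \<Longrightarrow> j < length \<beta>s \<Longrightarrow> p i + length (\<beta>s ! i) \<le> p j"
    and tab: "\<And>j i. j < length \<beta>s \<Longrightarrow> i < length (\<beta>s ! j) \<Longrightarrow> inv_table \<sigma> (p j + i) = inv_table (\<beta>s ! j) i"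
  shows "contains_vincular \<sigma> \<pi> A"
proof -
  have "\<forall>t\<in>{..<length \<pi>}. \<exists>x. fst x < length \<beta>s \<and> snd x < length (\<beta>s ! fst x) \<and> t = offset \<beta>s (fst x) + snd x"
    using offset_locate[of _ \<beta>s "length \<beta>s"] by (fastforce simp: \<pi> length_direct_sums)
  then obtain h where h: "\<And>t. t < length \<pi> \<Longrightarrow>
      fst (h t) < length \<beta>s \<and> snd (h t) < length (\<beta>s ! fst (h t)) \<and> t = offset \<beta>s (fst (h t)) + snd (h t)"
    by (metis lessThan_iff)
  define J I where "J t = fst (h t)" and "I t = snd (h t)" for t
  have JI: "J t < length \<beta>s" "I t < length (\<beta>s ! J t)" "t = offset \<beta>s (J t) + I t" if "t < length \<pi>" for t
    using h[OF that] by (auto simp: J_def I_def)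
  define f where "f t = p (J t) + I t" for t
  have J_mono: "J t \<le> J t'" if "t < t'" "t' < length \<pi>" for t t'
  proof (rule ccontr)
    assume "\<not> J t \<le> J t'"
    then have "offset \<beta>s (J t') + length (\<beta>s ! J t') \<le> offset \<beta>s (J t)"
      using that JI by (intro offset_less) auto
    then show False using JI(2,3)[of t'] JI(3)[of t] that by linarith
  qed
  have f_bound: "f t < length \<sigma>" if "t < length \<pi>" for t
    using JI[OF that] p(1)[of "J t"] by (simp add: f_def)
  have f_lt: "f t < p (J t')" if "t < length \<pi>" "t' < length \<pi>" "J t < J t'" for t t'
    using JI[OF that(1)] JI[OF that(2)] p(2)[OF that(3)] by (simp add: f_def)
  have mono: "f t < f t'" if "t < t'" "t' < length \<pi>" for t t'
  proof (cases "J t = J t'")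
    case True
    then show ?thesis using that JI(3)[of t] JI(3)[of t'] by (simp add: f_def)
  next
    case False
    then have "J t < J t'" using J_mono[OF that] by simp
    then have "f t < p (J t')" using that by (intro f_lt) auto
    then show ?thesis by (simp add: f_def)
  qed
  have dist: "distinct \<beta>" if "\<beta> \<in> set \<beta>s" for \<beta>
    using perm[OF that] by (simp add: is_perm_def permutations_of_set_def)
  have \<pi>_nth: "\<pi> ! t = offset \<beta>s (J t) + \<beta>s ! J t ! I t" if "t < length \<pi>" for t
    using JI[OF that] direct_sums_nth[of "J t" \<beta>s "I t"] by (simp add: \<pi>)
  have blk: "1 \<le> \<beta>s ! J t ! I t" "\<beta>s ! J t ! I t \<le> length (\<beta>s ! J t)" if "t < length \<pi>" for t
  proof -
    have "\<beta>s ! J t ! I t \<in> set (\<beta>s ! J t)" using JI[OF that] by simp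
    moreover have "set (\<beta>s ! J t) = {1..length (\<beta>s ! J t)}"
      using perm[of "\<beta>s ! J t"] JI(1)[OF that] by (simp add: is_perm_iff)
    ultimately show "1 \<le> \<beta>s ! J t ! I t" "\<beta>s ! J t ! I t \<le> length (\<beta>s ! J t)" by simp_all
  qed
  have across: "\<pi> ! a < \<pi> ! b \<and> \<sigma> ! f a < \<sigma> ! f b"
    if "a < length \<pi>" "b < length \<pi>" "J a < J b" for a b
  proof
    have "offset \<beta>s (J a) + length (\<beta>s ! J a) \<le> offset \<beta>s (J b)"
      using that JI by (intro offset_less) auto
    then show "\<pi> ! a < \<pi> ! b" using blk[OF that(1)] blk[OF that(2)] \<pi>_nth that by simp
    show "\<sigma> ! f a < \<sigma> ! f b"
      unfolding f_def[of b]
    proof (rule window_order(1))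
      show "p (J b) + length (\<beta>s ! J b) \<le> length \<sigma>" using p(1) JI that by auto
      show "I b < length (\<beta>s ! J b)" using JI that by auto
      show "distinct (\<beta>s ! J b)" using dist JI that by auto
      show "f a < p (J b)" using f_lt that by auto
    qed (use assms(1) tab JI that in auto)
  qed
  have order: "\<sigma> ! f a < \<sigma> ! f b \<longleftrightarrow> \<pi> ! a < \<pi> ! b" if "a < length \<pi>" "b < length \<pi>" for a b
  proof -
    consider "J a < J b" | "J b < J a" | "J a = J b" by linarith
    then show ?thesis
    proof cases
      case 3
      have "\<sigma> ! (p (J a) + I a) < \<sigma> ! (p (J a) + I b) \<longleftrightarrow> \<beta>s ! J a ! I a < \<beta>s ! J a ! I b"
      proof (rule window_order(2))
        show "p (J a) + length (\<beta>s ! J a) \<le> length \<sigma>" using p(1) JI that by auto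
        show "distinct (\<beta>s ! J a)" using dist JI that by auto
        show "I a < length (\<beta>s ! J a)" using JI that by auto
        show "I b < length (\<beta>s ! J a)" using JI[of b] that 3 by auto
      qed (use assms(1) tab JI that in auto)
      then show ?thesis using \<pi>_nth that 3 by (simp add: f_def)
    next
      case 1
      then show ?thesis using across[of a b] that by simp
    next
      case 2
      then show ?thesis using across[of b a] that by simp
    qed
  qed
  have adj: "f t = f (t - 1) + 1" if "t \<in> A" for t
  proof -
    have t: "0 < t" "t < length \<pi>" using A(1) that by (auto dest!: subsetD)
    have J: "J (t - 1) = J t"
    proof (rule ccontr)
      assume "J (t - 1) \<noteq> J t"
      then have lt: "J (t - 1) < J t" using J_mono[of "t - 1" t] t by simp
      then have "offset \<beta>s (J (t - 1)) + length (\<beta>s ! J (t - 1)) \<le> offset \<beta>s (J t)"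
        using t JI by (intro offset_less) auto
      then have "t = offset \<beta>s (J t)" using JI[of "t - 1"] JI[of t] t by linarith
      then show False using A(2)[of "J t"] lt JI(1)[of t] t that by auto
    qed
    have "t - 1 < length \<pi>" using t by simp
    then have "t - 1 = offset \<beta>s (J t) + I (t - 1)" using JI(3)[of "t - 1"] J by simp
    then have "I t = I (t - 1) + 1" using JI(3)[OF t(2)] t(1) by linarith
    then show ?thesis using J by (simp add: f_def)
  qed
  show ?thesis
    unfolding contains_vincular_def
  proof (intro exI[of _ f] conjI)
    show "strict_mono_on {..<length \<pi>} f" using mono by (auto simp: strict_mono_on_def)
  qed (use f_bound order adj in auto)
qed

section \<open>The structure of supercomponents\<close>

text \<open>
  Otherwise the first \<open>y\<close> values all lie below the rest, hence are \<open>{1..y}\<close>.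
\<close>
lemma indecomposable_crossing:
  assumes "indecomposable \<alpha>" "0 < y" "y < length \<alpha>"
  shows "\<exists>u<y. \<exists>v. y \<le> v \<and> v < length \<alpha> \<and> \<alpha> ! u > \<alpha> ! v"
proof (rule ccontr)
  assume no: "\<not> ?thesis"
  have dist: "distinct \<alpha>" and set: "set \<alpha> = {1..length \<alpha>}"
    using assms(1) by (auto simp: indecomposable_def is_perm_def permutations_of_set_def)
  let ?S = "set (take y \<alpha>)"
  have card: "card ?S = y" using dist assms(3) by (simp add: distinct_card)
  have down: "x' \<in> ?S" if x: "x \<in> ?S" "1 \<le> x'" "x' < x" for x x'
  proof (rule ccontr)
    assume "x' \<notin> ?S"
    have sub: "?S \<subseteq> {1..length \<alpha>}" using set set_take_subset by fastforce
    then have "x' \<in> set \<alpha>" using x set by auto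
    then obtain v where v: "v < length \<alpha>" "\<alpha> ! v = x'" by (auto simp: in_set_conv_nth)
    obtain u where u: "u < y" "\<alpha> ! u = x" using x(1) by (auto simp: in_set_conv_nth)
    have "y \<le> v"
    proof (rule ccontr)
      assume "\<not> y \<le> v"
      then have "take y \<alpha> ! v \<in> ?S" using assms(3) by (intro nth_mem) simp
      then show False using \<open>x' \<notin> ?S\<close> v \<open>\<not> y \<le> v\<close> by simp
    qed
    then show False using no u v x(3) by blast
  qed
  have ne: "?S \<noteq> {}" using assms(2) card by auto
  have "?S = {1..Max ?S}"
  proof
    show "?S \<subseteq> {1..Max ?S}" using set set_take_subset[of y \<alpha>] by (auto dest!: subsetD)
    show "{1..Max ?S} \<subseteq> ?S"
    proof
      fix x assume "x \<in> {1..Max ?S}"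
      then show "x \<in> ?S" using down[of "Max ?S" x] Max_in[OF _ ne] by (cases "x = Max ?S") auto
    qed
  qed
  then have "?S = {1..y}" using card by (metis card_atLeastAtMost diff_Suc_1)
  then show False using assms by (auto simp: indecomposable_def Suc_le_eq)
qed

text \<open>
  All that the proof needs to know about supercomponents. A supercomponent is a maximal part of the
  pattern that cannot be cut: a gap between two of them carries neither an adjacency requirement
  nor a crossing inversion, while each gap inside one of them carries at least one of the two.
\<close>
lemma supercomponents_structure:
  fixes A :: "nat set"
  assumes "is_perm \<pi>"
  defines "\<beta>s \<equiv> supercomponents \<pi> A"
  shows "direct_sums \<beta>s = \<pi>"
    and "\<And>\<beta>. \<beta> \<in> set \<beta>s \<Longrightarrow> is_perm \<beta>"
    and "\<And>j. 0 < j \<Longrightarrow> j < length \<beta>s \<Longrightarrow> offset \<beta>s j \<notin> A"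
    and "\<And>j t. j < length \<beta>s \<Longrightarrow> 0 < t \<Longrightarrow> t < length (\<beta>s ! j) \<Longrightarrow> offset \<beta>s j + t \<notin> A \<Longrightarrow>
        \<exists>u<t. \<exists>v. t \<le> v \<and> v < length (\<beta>s ! j) \<and> \<beta>s ! j ! u > \<beta>s ! j ! v"
proof -
  have "are_supercomponents \<pi> A \<beta>s"
    unfolding \<beta>s_def by (rule are_supercomponents_supercomponents[OF assms(1)])
  then obtain \<alpha>s b where dec: "is_sum_decomposition \<pi> \<alpha>s"
    and mono: "mono_on {..<length \<alpha>s} b" and im: "b ` {..<length \<alpha>s} = {..<length \<beta>s}"
    and adj: "\<forall>i. Suc i < length \<alpha>s \<longrightarrow> (b i = b (Suc i) \<longleftrightarrow> sum_list (map length (take (Suc i) \<alpha>s)) \<in> A)"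
    and \<beta>: "\<forall>j<length \<beta>s. \<beta>s ! j = direct_sums (nths \<alpha>s {i. b i = j})"
    unfolding are_supercomponents_def by (elim exE conjE) (rule that)
  let ?r = "length \<alpha>s" and ?l = "length \<beta>s"
  \<comment> \<open>\<open>c j\<close> is the number of components that lie in the first \<open>j\<close> supercomponents.\<close>
  define c where "c j = (LEAST i. i = ?r \<or> i < ?r \<and> j \<le> b i)" for j
  have c_le: "c j \<le> ?r" for j unfolding c_def by (rule Least_le) simp
  have c_iff: "b i < j \<longleftrightarrow> i < c j" if "i < ?r" for i j
  proof
    assume "b i < j"
    show "i < c j"
    proof (rule ccontr)
      assume "\<not> i < c j"
      have "c j = ?r \<or> c j < ?r \<and> j \<le> b (c j)" unfolding c_def by (rule LeastI[of _ ?r]) simp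
      then have "j \<le> b (c j)" "c j \<le> i" using that \<open>\<not> i < c j\<close> by auto
      then show False using mono_onD[OF mono, of "c j" i] that \<open>b i < j\<close> by auto
    qed
  next
    assume "i < c j"
    then show "b i < j" using not_less_Least[of i "\<lambda>i. i = ?r \<or> i < ?r \<and> j \<le> b i"] that
      by (auto simp: c_def)
  qed
  have c0: "c 0 = 0" using c_iff[of 0 0] c_le[of 0] by (cases "?r = 0") auto
  have cl: "c ?l = ?r"
  proof (rule ccontr)
    assume "c ?l \<noteq> ?r"
    then have "c ?l < ?r" using c_le[of ?l] by simp
    then have "\<not> b (c ?l) < ?l" "b (c ?l) \<in> {..<?l}" using c_iff[of "c ?l" ?l] im by blast+
    then show False by simp
  qed
  have c_mono: "c j \<le> c (Suc j)" for j
  proof (rule ccontr)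
    assume "\<not> c j \<le> c (Suc j)"
    then have "c (Suc j) < ?r" "c (Suc j) < c j" using c_le[of j] by auto
    then show False using c_iff[of "c (Suc j)" j] c_iff[of "c (Suc j)" "Suc j"] by auto
  qed
  \<comment> \<open>\<open>sl j\<close> lists the components of the \<open>j\<close>th supercomponent.\<close>
  define sl where "sl j = drop (c j) (take (c (Suc j)) \<alpha>s)" for j
  have b_eq: "b i = j \<longleftrightarrow> c j \<le> i \<and> i < c (Suc j)" if "i < ?r" for i j
    using c_iff[OF that, of j] c_iff[OF that, of "Suc j"] by auto
  have nths: "nths \<alpha>s {i. b i = j} = sl j" for j
  proof -
    have len: "length (sl j) = c (Suc j) - c j" "length (take (c j) \<alpha>s) = c j"
      using c_le[of "Suc j"] c_le[of j] by (auto simp: sl_def)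
    have emp: "nths xs I = []" if "\<forall>i<length xs. i \<notin> I" for xs :: "nat list list" and I
      using that by (intro length_0_conv[THEN iffD1]) (simp add: length_nths card_eq_0_iff)
    have "\<alpha>s = take (c j) \<alpha>s @ sl j @ drop (c (Suc j)) \<alpha>s"
      using c_mono[of j] unfolding sl_def
      by (metis append.assoc append_take_drop_id min.absorb1 take_take)
    then have "nths \<alpha>s {i. b i = j} = nths (take (c j) \<alpha>s @ sl j @ drop (c (Suc j)) \<alpha>s) {i. b i = j}"
      by simp
    also have "\<dots> = nths (take (c j) \<alpha>s) {i. b i = j} @ nths (sl j) {i. b (i + c j) = j}
        @ nths (drop (c (Suc j)) \<alpha>s) {i. b (i + c (Suc j)) = j}"
      using len c_mono[of j] by (simp add: nths_append add.assoc)
    also have "nths (take (c j) \<alpha>s) {i. b i = j} = []"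
      by (rule emp) (use b_eq c_le[of j] in auto)
    also have "nths (drop (c (Suc j)) \<alpha>s) {i. b (i + c (Suc j)) = j} = []"
      by (rule emp) (use b_eq in auto)
    also have "nths (sl j) {i. b (i + c j) = j} = sl j"
      by (rule nths_all) (use b_eq c_le[of "Suc j"] len in auto)
    finally show ?thesis by simp
  qed
  have \<beta>_sl: "\<beta>s ! j = direct_sums (sl j)" if "j < ?l" for j using \<beta> nths that by simp
  have pre: "direct_sums (take j \<beta>s) = direct_sums (take (c j) \<alpha>s)" if "j \<le> ?l" for j
    using that
  proof (induction j)
    case (Suc j)
    have "take (c (Suc j)) \<alpha>s = take (c j) \<alpha>s @ sl j"
      unfolding sl_def using c_mono[of j] by (metis append_take_drop_id min.absorb1 take_take)
    then show ?case using Suc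
      by (simp add: take_Suc_conv_app_nth direct_sums_append direct_sum_def \<beta>_sl)
  qed (simp add: c0)
  show "direct_sums \<beta>s = \<pi>" using pre[of ?l] cl dec by (simp add: is_sum_decomposition_def)
  have ind: "indecomposable \<alpha>" if "\<alpha> \<in> set \<alpha>s" for \<alpha>
    using dec that by (simp add: is_sum_decomposition_def)
  have sl_sub: "set (sl j) \<subseteq> set \<alpha>s" for j
    unfolding sl_def by (meson order.trans set_drop_subset set_take_subset)
  show "is_perm \<beta>" if \<beta>: "\<beta> \<in> set \<beta>s" for \<beta>
  proof -
    obtain j where j: "j < ?l" "\<beta> = \<beta>s ! j" using \<beta> by (metis in_set_conv_nth)
    have "is_perm (direct_sums (sl j))"
      using ind sl_sub[of j] by (intro is_perm_direct_sums) (auto simp: indecomposable_def)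
    then show ?thesis using j \<beta>_sl by simp
  qed
  have off: "offset \<beta>s j = offset \<alpha>s (c j)" if "j \<le> ?l" for j
    using arg_cong[OF pre[OF that], of length] c_le[of j] that
    by (simp add: length_direct_sums offset_def)
  show "offset \<beta>s j \<notin> A" if j: "0 < j" "j < ?l" for j
  proof -
    have "0 \<in> b ` {..<?r}" "j \<in> b ` {..<?r}" unfolding im using j by auto
    then obtain i i' where i: "i < ?r" "b i = 0" "i' < ?r" "b i' = j" by auto
    have "0 < c j" using c_iff[of i j] i j by auto
    moreover have "c j < ?r" using c_iff[of i' j] i by auto
    ultimately have "b (c j - 1) < j" "\<not> b (c j) < j"
      using c_iff[of "c j - 1" j] c_iff[of "c j" j] by auto
    then have "b (c j - 1) \<noteq> b (Suc (c j - 1))" using \<open>0 < c j\<close> by auto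
    then have "offset \<alpha>s (Suc (c j - 1)) \<notin> A"
      using adj[rule_format, of "c j - 1"] \<open>0 < c j\<close> \<open>c j < ?r\<close> by (simp add: offset_def)
    then show ?thesis using off[of j] j \<open>0 < c j\<close> by simp
  qed
  show "\<exists>u<t. \<exists>v. t \<le> v \<and> v < length (\<beta>s ! j) \<and> \<beta>s ! j ! u > \<beta>s ! j ! v"
    if j: "j < ?l" and t: "0 < t" "t < length (\<beta>s ! j)" and nA: "offset \<beta>s j + t \<notin> A" for j t
  proof -
    have "t < offset (sl j) (length (sl j))" using t \<beta>_sl[OF j] by (simp add: length_direct_sums)
    then obtain x y where xy: "x < length (sl j)" "y < length (sl j ! x)" "t = offset (sl j) x + y"
      using offset_locate[of t "sl j" "length (sl j)"] by blast
    have len: "length (sl j) = c (Suc j) - c j" using c_le[of "Suc j"] by (simp add: sl_def)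
    have "0 < y"
    proof (rule ccontr)
      assume "\<not> 0 < y"
      then have tx: "t = offset (sl j) x" "x \<noteq> 0" using xy t by (auto intro: gr0I)
      define i where "i = c j + x - 1"
      have i: "Suc i = c j + x" "c j \<le> i" "Suc i < c (Suc j)" using xy(1) len tx(2) by (auto simp: i_def)
      then have "Suc i < ?r" using c_le[of "Suc j"] by simp
      then have "b i = b (Suc i)" using b_eq[of i j] b_eq[of "Suc i" j] i by simp
      then have "offset \<alpha>s (Suc i) \<in> A" using adj \<open>Suc i < ?r\<close> by (simp add: offset_def)
      moreover have "offset \<alpha>s (Suc i) = offset \<beta>s j + t"
      proof -
        have "take x (sl j) = take x (drop (c j) \<alpha>s)"
          using xy(1) len by (simp add: sl_def drop_take)
        then show ?thesis
          using off[of j] j tx(1) i(1) by (simp add: offset_def take_add)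
      qed
      ultimately show False using nA by simp
    qed
    moreover have "indecomposable (sl j ! x)" using ind sl_sub[of j] xy(1) nth_mem by blast
    ultimately obtain u v where uv: "u < y" "y \<le> v" "v < length (sl j ! x)" "sl j ! x ! u > sl j ! x ! v"
      using indecomposable_crossing[of "sl j ! x" y] xy(2) by blast
    have "offset (sl j) x + v < length (\<beta>s ! j)"
    proof -
      have "offset (sl j) x + length (sl j ! x) \<le> offset (sl j) (length (sl j))"
        using xy(1) by (rule offset_less[OF xy(1)])
      then show ?thesis using uv(3) \<beta>_sl[OF j] by (simp add: length_direct_sums)
    qed
    moreover have "\<beta>s ! j ! (offset (sl j) x + u) > \<beta>s ! j ! (offset (sl j) x + v)"
      using direct_sums_nth[OF xy(1), of u] direct_sums_nth[OF xy(1), of v] uv \<beta>_sl[OF j] by simp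
    ultimately show ?thesis
      using uv xy(3) by (intro exI[of _ "offset (sl j) x + u"] conjI exI[of _ "offset (sl j) x + v"]) auto
  qed
qed


section \<open>Occurrences force heavy windows\<close>

text \<open>
  Send a crossed gap \<open>g\<close> to the inversion \<open>(a g, d g)\<close> formed by the largest term up to \<open>g\<close> and
  the first term after \<open>g\<close> that is smaller. If gaps \<open>g < g'\<close> were sent to the same inversion, then
  the term at \<open>Suc g\<close> would be neither below the maximum (\<open>d g\<close> comes first) nor above it (it lies
  in the range of the maximum for \<open>g'\<close>), so it would repeat its value.
\<close>
lemma card_crossed_gaps_le:
  fixes x :: "nat \<Rightarrow> nat"
  assumes "inj_on x {p..q}"
  shows "card {g \<in> {p..<q}. \<exists>i j. p \<le> i \<and> i \<le> g \<and> g < j \<and> j \<le> q \<and> x i > x j}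
       \<le> card {(i, j). p \<le> i \<and> i < j \<and> j \<le> q \<and> x i > x j}" (is "card ?G \<le> card ?I")
proof (rule card_inj_on_le)
  define a where "a g = (SOME i. i \<in> {p..g} \<and> (\<forall>i'\<in>{p..g}. x i' \<le> x i))" for g
  define d where "d g = (LEAST j. g < j \<and> x j < x (a g))" for g
  have a: "a g \<in> {p..g}" "\<And>i'. i' \<in> {p..g} \<Longrightarrow> x i' \<le> x (a g)" if "g \<in> ?G" for g
  proof -
    have "Max (x ` {p..g}) \<in> x ` {p..g}" using that by (intro Max_in) auto
    then obtain i where "i \<in> {p..g}" "x i = Max (x ` {p..g})" by auto
    then have "\<exists>i. i \<in> {p..g} \<and> (\<forall>i'\<in>{p..g}. x i' \<le> x i)" by (intro exI[of _ i]) auto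
    from someI_ex[OF this] show "a g \<in> {p..g}" "\<And>i'. i' \<in> {p..g} \<Longrightarrow> x i' \<le> x (a g)"
      by (auto simp: a_def)
  qed
  have d: "g < d g \<and> x (d g) < x (a g)" "d g \<le> q" if g: "g \<in> ?G" for g
  proof -
    obtain i j where ij: "p \<le> i" "i \<le> g" "g < j" "j \<le> q" "x i > x j" using g by auto
    then have "g < j \<and> x j < x (a g)" using a(2)[OF g, of i] by auto
    then show "g < d g \<and> x (d g) < x (a g)" "d g \<le> q"
      using LeastI[of "\<lambda>j. g < j \<and> x j < x (a g)" j] Least_le[of "\<lambda>j. g < j \<and> x j < x (a g)" j] ij(4)
      unfolding d_def by auto
  qed
  have ne: "(a g, d g) \<noteq> (a g', d g')" if g: "g \<in> ?G" and g': "g' \<in> ?G" and "g < g'" for g g'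
  proof
    assume eq: "(a g, d g) = (a g', d g')"
    have "\<not> x (Suc g) < x (a g)"
      using not_less_Least[of "Suc g" "\<lambda>j. g < j \<and> x j < x (a g)"] d[OF g'] eq that(3)
      by (auto simp: d_def)
    moreover have "x (Suc g) \<le> x (a g)" using a(2)[OF g', of "Suc g"] eq g that(3) by auto
    ultimately have "x (Suc g) = x (a g)" by simp
    then have "Suc g = a g" using inj_onD[OF assms, of "Suc g" "a g"] a(1)[OF g] g by auto
    then show False using a(1)[OF g] by simp
  qed
  show "inj_on (\<lambda>g. (a g, d g)) ?G"
  proof (rule inj_onI)
    fix g g' assume "g \<in> ?G" "g' \<in> ?G" "(a g, d g) = (a g', d g')"
    then show "g = g'" using ne[of g g'] ne[of g' g] by (cases g g' rule: linorder_cases) auto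
  qed
  show "(\<lambda>g. (a g, d g)) ` ?G \<subseteq> ?I"
  proof
    fix z assume "z \<in> (\<lambda>g. (a g, d g)) ` ?G"
    then obtain g where "z = (a g, d g)" "g \<in> ?G" by blast
    then show "z \<in> ?I" using a(1)[of g] d[of g] by auto
  qed
  show "finite ?I" by (rule finite_subset[of _ "{..q} \<times> {..q}"]) auto
qed

text \<open>
  Pigeonhole. Divide the interval into blocks of length \<open>2 * (s + k)\<close>. If each had sum below \<open>s\<close>, the
  density of \<open>e\<close> would be less than one half, against nearly \<open>1\<close> in a long interval; a short
  interval fits into one block.
\<close>
lemma heavy_window_of_dense_interval:
  fixes e :: "nat \<Rightarrow> nat"
  assumes "0 < s" "s \<le> sum e {p..<p+L}" "L \<le> sum e {p..<p+L} + k"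
  shows "\<exists>q. s \<le> sum e {q..<q + 2 * (s + k)}"
proof (rule ccontr)
  assume no: "\<not> ?thesis"
  define K where "K = 2 * (s + k)"
  have lt: "sum e {q..<q+K} \<le> s - 1" for q
  proof -
    have "\<not> s \<le> sum e {q..<q+K}" using no unfolding K_def by blast
    then show ?thesis by simp
  qed
  have blocks: "sum e {p..<p + c * K} \<le> c * (s - 1)" for c
  proof (induction c)
    case (Suc c)
    have "sum e {p..<p + Suc c * K} = sum e {p..<p + c * K} + sum e {p + c * K..<p + c * K + K}"
      by (subst sum.atLeastLessThan_concat) (auto simp: algebra_simps)
    then show ?case using Suc lt[of "p + c * K"] by simp
  qed simp
  define c where "c = L div K"
  have K: "0 < K" using assms(1) by (simp add: K_def)
  have L: "c * K \<le> L" "L \<le> Suc c * K"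
    using div_mult_mod_eq[of L K] mod_less_divisor[OF K, of L] unfolding c_def mult_Suc by linarith+
  have "sum e {p..<p+L} \<le> sum e {p..<p + Suc c * K}"
    using L(2) by (intro sum_mono2) auto
  also have "\<dots> \<le> Suc c * (s - 1)" by (rule blocks)
  finally have S: "sum e {p..<p+L} \<le> Suc c * (s - 1)" .
  show False
  proof (cases "c = 0")
    case True
    then show False using S assms(1,2) by simp
  next
    case False
    obtain r where r: "s = Suc r" using assms(1) by (cases s) auto
    have "c * K \<le> Suc c * (s - 1) + k" using S L assms(3) by linarith
    then have "2 * (c * r) + 2 * c + 2 * (c * k) \<le> c * r + r + k" by (simp add: K_def r algebra_simps)
    moreover have "r \<le> c * r" "k \<le> c * k" using False by auto
    ultimately show False using False by linarith
  qed
qed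

text \<open>
  The interval \<open>{p..q}\<close> spanned by the occurrence of \<open>\<beta>\<close> inherits the \<open>s\<close> inversions of \<open>\<beta>\<close>. A gap
  of the interval lies between the images of two consecutive positions of \<open>\<beta>\<close>; either these images
  are adjacent, which happens for at most \<open>length \<pi>\<close> gaps, or an inversion of \<open>\<beta>\<close> crosses the gap.
\<close>
lemma contains_heavy_window:
  assumes cont: "contains_vincular \<sigma> \<pi> A" and "distinct \<sigma>" and "is_perm \<pi>"
    and \<beta>: "\<beta> \<in> set (supercomponents \<pi> A)" "num_inversions \<beta> = s" "0 < s"
  shows "\<exists>q. s \<le> sum (inv_table \<sigma>) {q..<q + 2 * (s + Suc (length \<pi>))}"
proof -
  define \<beta>s where "\<beta>s = supercomponents \<pi> A"
  note st = supercomponents_structure[OF assms(3), where A = A, folded \<beta>s_def]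
  obtain j where j: "j < length \<beta>s" "\<beta> = \<beta>s ! j" using \<beta>(1) by (metis \<beta>s_def in_set_conv_nth)
  obtain f where mono: "strict_mono_on {..<length \<pi>} f" and f_bd: "f ` {..<length \<pi>} \<subseteq> {..<length \<sigma>}"
    and ord: "\<forall>a<length \<pi>. \<forall>b<length \<pi>. \<sigma> ! f a < \<sigma> ! f b \<longleftrightarrow> \<pi> ! a < \<pi> ! b"
    and adj: "\<forall>t\<in>A. f t = f (t - 1) + 1"
    using cont unfolding contains_vincular_def by blast
  let ?o = "offset \<beta>s j" and ?l = "length \<beta>"
  have ol: "?o + ?l \<le> length \<pi>"
    using offset_less[OF j(1) j(1)] st(1) j(2) by (metis length_direct_sums)
  have l: "2 \<le> ?l"
  proof (rule ccontr)
    assume "\<not> 2 \<le> ?l"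
    then have "{(i, j). i < j \<and> j < ?l \<and> \<beta> ! i > \<beta> ! j} = {}" by auto
    then have "num_inversions \<beta> = 0" by (simp only: num_inversions_def card.empty)
    then show False using \<beta>(2,3) by simp
  qed
  have less: "f a < f b" if "a < b" "b < length \<pi>" for a b
    using strict_mono_onD[OF mono, of a b] that by simp
  then have le: "f a \<le> f b" if "a \<le> b" "b < length \<pi>" for a b
    using that by (cases "a = b") (auto intro: less_imp_le)
  define p q where "p = f ?o" and "q = f (?o + ?l - 1)"
  have q_bd: "q < length \<sigma>" using f_bd ol l unfolding q_def by (auto simp: image_subset_iff)
  have pq: "p \<le> q" unfolding p_def q_def using ol l by (intro le) auto
  have in_pq: "p \<le> f (?o + u)" "f (?o + u) \<le> q" if "u < ?l" for u
    unfolding p_def q_def using that ol by (auto intro: le)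
  have \<beta>_ord: "\<beta> ! u > \<beta> ! v \<longleftrightarrow> \<sigma> ! f (?o + u) > \<sigma> ! f (?o + v)" if "u < ?l" "v < ?l" for u v
    using direct_sums_nth[OF j(1), of u] direct_sums_nth[OF j(1), of v] ord that ol j(2) st(1) by auto
  let ?I = "{(i, j). p \<le> i \<and> i < j \<and> j \<le> q \<and> \<sigma> ! i > \<sigma> ! j}"
  have finI: "finite ?I" by (rule finite_subset[of _ "{..q} \<times> {..q}"]) auto
  have "card ?I \<le> card (SIGMA y:{p..<p + (q - p + 1)}. {i. i < y \<and> \<sigma> ! i > \<sigma> ! y})"
    by (rule card_inj_on_le[of prod.swap]) auto
  also have "\<dots> = sum (inv_table \<sigma>) {p..<p + (q - p + 1)}"
    using q_bd pq by (subst card_SigmaI) (auto simp: inv_table_def intro!: sum.cong)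
  finally have sum_ge: "card ?I \<le> sum (inv_table \<sigma>) {p..<p + (q - p + 1)}" .
  have "s \<le> card ?I"
    unfolding \<beta>(2)[symmetric] num_inversions_def
  proof (rule card_inj_on_le[OF _ _ finI])
    let ?h = "\<lambda>(u, v). (f (?o + u), f (?o + v))"
    have "inj_on f {..<length \<pi>}" using mono by (rule strict_mono_on_imp_inj_on)
    then have fe: "u = v" if "f (?o + u) = f (?o + v)" "u < ?l" "v < ?l" for u v
      using that ol inj_onD[of f "{..<length \<pi>}" "?o + u" "?o + v"] by auto
    show "inj_on ?h {(i, j). i < j \<and> j < ?l \<and> \<beta> ! i > \<beta> ! j}"
      by (rule inj_onI) (auto dest!: fe)
    show "?h ` {(i, j). i < j \<and> j < ?l \<and> \<beta> ! i > \<beta> ! j} \<subseteq> ?I"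
      using in_pq \<beta>_ord ol by (auto intro: less)
  qed
  then have s_le: "s \<le> sum (inv_table \<sigma>) {p..<p + (q - p + 1)}" using sum_ge by simp
  let ?G = "{g \<in> {p..<q}. \<exists>i j. p \<le> i \<and> i \<le> g \<and> g < j \<and> j \<le> q \<and> \<sigma> ! i > \<sigma> ! j}"
  have "{p..<q} \<subseteq> ?G \<union> f ` {..<length \<pi>}"
  proof
    fix g assume g: "g \<in> {p..<q}"
    \<comment> \<open>The gap \<open>g\<close> lies between the images of \<open>t - 1\<close> and \<open>t\<close>.\<close>
    define t where "t = (LEAST t. ?o < t \<and> g < f t)"
    have ex: "?o < ?o + ?l - 1 \<and> g < f (?o + ?l - 1)" using g l by (simp add: q_def)
    have t: "?o < t" "g < f t" using LeastI[of "\<lambda>t. ?o < t \<and> g < f t", OF ex] by (auto simp: t_def)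
    have t_le: "t \<le> ?o + ?l - 1" unfolding t_def by (rule Least_le) (rule ex)
    have t1: "f (t - 1) \<le> g"
    proof (cases "t - 1 = ?o")
      case False
      then show ?thesis using not_less_Least[of "t - 1" "\<lambda>t. ?o < t \<and> g < f t"] t by (auto simp: t_def)
    qed (use g in \<open>simp add: p_def\<close>)
    show "g \<in> ?G \<union> f ` {..<length \<pi>}"
    proof (cases "t \<in> A")
      case True
      then have "g = f (t - 1)" using adj t t1 by force
      then show ?thesis using t_le ol l by auto
    next
      case False
      have to: "0 < t - ?o" "t - ?o < ?l" "?o + (t - ?o) = t" using t t_le l by auto
      then obtain u v where uv: "u < t - ?o" "t - ?o \<le> v" "v < ?l" "\<beta> ! u > \<beta> ! v"
        using st(4)[of j "t - ?o"] j False by auto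
      have "f (?o + u) \<le> f (t - 1)" using uv t_le ol l by (intro le) auto
      moreover have "f t \<le> f (?o + v)" using uv ol by (intro le) auto
      ultimately have "p \<le> f (?o + u) \<and> f (?o + u) \<le> g \<and> g < f (?o + v) \<and> f (?o + v) \<le> q
          \<and> \<sigma> ! f (?o + u) > \<sigma> ! f (?o + v)"
        using in_pq uv t t1 \<beta>_ord by auto
      then show ?thesis using g by blast
    qed
  qed
  then have "card {p..<q} \<le> card (?G \<union> f ` {..<length \<pi>})" by (rule card_mono[rotated]) auto
  also have "\<dots> \<le> card ?G + card (f ` {..<length \<pi>})" by (rule card_Un_le)
  also have "\<dots> \<le> card ?I + length \<pi>"
  proof (rule add_mono)
    have "inj_on ((!) \<sigma>) {p..q}"
      using assms(2) q_bd by (auto simp: inj_on_def nth_eq_iff_index_eq)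
    then show "card ?G \<le> card ?I" by (rule card_crossed_gaps_le)
    show "card (f ` {..<length \<pi>}) \<le> length \<pi>" using card_image_le[of "{..<length \<pi>}" f] by simp
  qed
  finally have "q - p + 1 \<le> sum (inv_table \<sigma>) {p..<p + (q - p + 1)} + Suc (length \<pi>)"
    using sum_ge by simp
  then show ?thesis by (rule heavy_window_of_dense_interval[OF \<beta>(3) s_le])
qed

section \<open>Probability bounds for a fixed length\<close>

lemma finite_perms_with_inversions [simp]: "finite (perms_with_inversions n m)"
  by (simp add: perms_with_inversions_def)

lemma perms_with_inversionsD:
  assumes "\<sigma> \<in> perms_with_inversions n m"
  shows "length \<sigma> = n" "distinct \<sigma>" "is_perm \<sigma>" "inv_table \<sigma> \<in> inv_tables n m"
  using assms permutations_of_set_atLeast1D[of \<sigma> n] bij_betw_inv_table[of n m]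
  by (auto simp: perms_with_inversions_def is_perm_iff bij_betw_def)

lemma prob_random_perm:
  assumes "perms_with_inversions n m \<noteq> {}"
  shows "measure_pmf.prob (random_perm n m) {\<sigma>. P \<sigma>}
    = card {\<sigma> \<in> perms_with_inversions n m. P \<sigma>} / card (perms_with_inversions n m)"
proof -
  have "perms_with_inversions n m \<inter> {\<sigma>. P \<sigma>} = {\<sigma> \<in> perms_with_inversions n m. P \<sigma>}" by blast
  then show ?thesis using assms by (simp add: random_perm_def measure_pmf_of_set)
qed

lemma perms_with_inversions_nonempty: "m < n \<Longrightarrow> perms_with_inversions n m \<noteq> {}"
  using bij_betw_inv_table[of n m] inv_tables_nonempty[of m n] by (auto simp: bij_betw_def)

lemma prob_random_perm_le:
  assumes "m < n" "\<And>\<sigma>. \<sigma> \<in> perms_with_inversions n m \<Longrightarrow> P \<sigma> \<Longrightarrow> Q (inv_table \<sigma>)"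
  shows "measure_pmf.prob (random_perm n m) {\<sigma>. P \<sigma>}
    \<le> card {e \<in> inv_tables n m. Q e} / card (inv_tables n m)"
proof -
  have "card {\<sigma> \<in> perms_with_inversions n m. P \<sigma>} \<le> card {e \<in> inv_tables n m. Q e}"
  proof (rule card_inj_on_le)
    show "inj_on inv_table {\<sigma> \<in> perms_with_inversions n m. P \<sigma>}"
      using bij_betw_imp_inj_on[OF bij_betw_inv_table] by (rule inj_on_subset) auto
    show "inv_table ` {\<sigma> \<in> perms_with_inversions n m. P \<sigma>} \<subseteq> {e \<in> inv_tables n m. Q e}"
      using assms(2) perms_with_inversionsD(4) by blast
  qed simp
  moreover have "card (perms_with_inversions n m) = card (inv_tables n m)"
    by (rule bij_betw_same_card[OF bij_betw_inv_table])
  ultimately show ?thesis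
    by (simp add: prob_random_perm[OF perms_with_inversions_nonempty[OF assms(1)]] divide_right_mono)
qed

lemma is_perm_of_vincular_pattern:
  assumes "vincular_pattern \<pi> A"
  shows "is_perm \<pi>" "A \<subseteq> {1..length \<pi> - 1}" "0 < length \<pi>"
  using assms by (auto simp: vincular_pattern_def)

lemma supercomponents_nonempty:
  assumes "vincular_pattern \<pi> A" shows "supercomponents \<pi> A \<noteq> []"
  using supercomponents_structure(1)[OF is_perm_of_vincular_pattern(1)[OF assms], of A]
    is_perm_of_vincular_pattern(3)[OF assms] by (metis direct_sums_simps(1) list.size(3) less_irrefl)

lemma prob_contains_le:
  assumes pat: "vincular_pattern \<pi> A" and s: "s = max_super_inversions \<pi> A" "0 < s" and "m < n"
  shows "measure_pmf.prob (random_perm n m) {\<sigma>. contains_vincular \<sigma> \<pi> A}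
    \<le> real n * (real (2 * (s + Suc (length \<pi>))) * real m) ^ s / real (n - m) ^ s"
proof -
  note \<pi> = is_perm_of_vincular_pattern[OF pat]
  let ?K = "2 * (s + Suc (length \<pi>))" and ?E = "card (inv_tables n m)"
  let ?H = "card {e \<in> inv_tables n m. \<exists>q. s \<le> sum e {q..<q + ?K}}"
  have "s \<in> num_inversions ` set (supercomponents \<pi> A)"
    unfolding s(1) max_super_inversions_def using supercomponents_nonempty[OF pat] by (intro Max_in) auto
  then obtain \<beta> where "\<beta> \<in> set (supercomponents \<pi> A)" "num_inversions \<beta> = s" by auto
  then have "measure_pmf.prob (random_perm n m) {\<sigma>. contains_vincular \<sigma> \<pi> A} \<le> ?H / ?E"
    using \<pi> s(2) perms_with_inversionsD(2)
    by (intro prob_random_perm_le[OF assms(4)] contains_heavy_window) auto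
  also have "\<dots> \<le> real n * (real ?K * real m) ^ s / real (n - m) ^ s"
  proof -
    have "0 < ?E" using inv_tables_nonempty[OF assms(4)] by (simp add: card_gt_0_iff)
    moreover have "real ?H * real (n - m) ^ s \<le> real n * (real ?K * real m) ^ s * real ?E"
      using of_nat_mono[OF card_heavy_window[OF s(2), of n m ?K], where 'a = real]
      by (simp only: of_nat_mult of_nat_power)
    moreover have "0 < real (n - m) ^ s" using assms(4) by simp
    ultimately show ?thesis by (simp only: pos_divide_le_eq pos_le_divide_eq of_nat_0_less_iff times_divide_eq_left)
  qed
  finally show ?thesis .
qed

text \<open>
  The blocks with index in \<open>{j * Q..<Suc j * Q}\<close> form the segment reserved for the \<open>j\<close>th
  supercomponent, so that the windows found in the segments come in the right order.
\<close>
lemma contains_if_occurrences: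
  assumes pat: "vincular_pattern \<pi> A" and "distinct \<sigma>"
  defines "\<beta>s \<equiv> supercomponents \<pi> A"
  assumes Q: "length \<beta>s * Q * length \<pi> \<le> length \<sigma>"
    and occ: "\<And>j. j < length \<beta>s \<Longrightarrow>
      occurrences (length \<pi>) {j * Q..<Suc j * Q} (length (\<beta>s ! j)) (inv_table (\<beta>s ! j)) (inv_table \<sigma>) \<noteq> {}"
  shows "contains_vincular \<sigma> \<pi> A"
proof -
  note \<pi> = is_perm_of_vincular_pattern[OF pat]
  note st = supercomponents_structure[OF \<pi>(1), where A = A, folded \<beta>s_def]
  have "\<forall>j. \<exists>u. j < length \<beta>s \<longrightarrow> u \<in> occurrences (length \<pi>) {j * Q..<Suc j * Q} (length (\<beta>s ! j))
      (inv_table (\<beta>s ! j)) (inv_table \<sigma>)"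
    using occ by blast
  then obtain u where u: "\<And>j. j < length \<beta>s \<Longrightarrow> u j \<in> occurrences (length \<pi>) {j * Q..<Suc j * Q}
      (length (\<beta>s ! j)) (inv_table (\<beta>s ! j)) (inv_table \<sigma>)"
    by metis
  have len: "length (\<beta>s ! j) \<le> length \<pi>" if "j < length \<beta>s" for j
    using offset_less[OF that that] st(1) by (metis length_direct_sums add_leE)
  have u_less: "u i < u j" if "i < j" "j < length \<beta>s" for i j
  proof -
    have "u i < Suc i * Q" "j * Q \<le> u j"
      using u[of i] u[of j] that by (auto simp: occurrences_def)
    moreover have "Suc i * Q \<le> j * Q" using that by (intro mult_le_mono1) simp
    ultimately show ?thesis by simp
  qed
  show ?thesis
  proof (rule contains_direct_sums[where p = "\<lambda>j. u j * length \<pi>"])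
    fix j assume j: "j < length \<beta>s"
    have "u j < Suc j * Q" using u[OF j] by (simp add: occurrences_def)
    also have "\<dots> \<le> length \<beta>s * Q" using j by (intro mult_le_mono1) simp
    finally have "Suc (u j) * length \<pi> \<le> length \<beta>s * Q * length \<pi>" by (intro mult_le_mono1) simp
    then show "u j * length \<pi> + length (\<beta>s ! j) \<le> length \<sigma>" using Q len[OF j] by simp
  next
    fix i j assume ij: "i < j" "j < length \<beta>s"
    have "Suc (u i) * length \<pi> \<le> u j * length \<pi>" using u_less[OF ij] by (intro mult_le_mono1) simp
    then show "u i * length \<pi> + length (\<beta>s ! i) \<le> u j * length \<pi>" using len[of i] ij by simp
  next
    fix j i assume "j < length \<beta>s" "i < length (\<beta>s ! j)"
    then show "inv_table \<sigma> (u j * length \<pi> + i) = inv_table (\<beta>s ! j) i"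
      using u[of j] by (simp add: occurrences_def)
  qed (use assms(2) \<pi>(2) st in auto)
qed

text \<open>
  The counting bound of the switching as a fraction, with \<open>m - t \<ge> m / 2\<close> and \<open>n + m \<le> 2 * n\<close>; as
  \<open>4 * n / m \<ge> 1\<close>, the exponent \<open>t\<close> may be raised to the common value \<open>s\<close>.
\<close>
lemma no_occurrence_fraction_le:
  fixes n m t s b :: nat and N E :: nat
  assumes count: "N * (m - t) ^ t * (b - m) \<le> E * Suc t * (n + m) ^ t"
    and "t \<le> s" "2 * s \<le> m" "0 < m" "m \<le> n" "m < b" "0 < E"
  shows "real N / real E \<le> real (Suc s) * (4 * real n / real m) ^ s / (real b - real m)"
proof -
  have "real N * (real m / 2) ^ t * (real b - real m) \<le> real N * real (m - t) ^ t * real (b - m)"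
    using assms by (intro mult_mono power_mono) auto
  also have "\<dots> \<le> real E * real (Suc t) * real (n + m) ^ t"
    using of_nat_mono[OF count, where 'a = real] by (simp only: of_nat_mult of_nat_power)
  also have "\<dots> \<le> real E * real (Suc s) * (2 * real n) ^ t"
    using assms by (intro mult_mono power_mono) auto
  finally have "real N / real E * (real b - real m) \<le> real (Suc s) * ((2 * real n) ^ t / (real m / 2) ^ t)"
    using assms by (simp add: field_simps)
  also have "(2 * real n) ^ t / (real m / 2) ^ t = (4 * real n / real m) ^ t"
    by (subst power_divide[symmetric]) simp
  also have "(4 * real n / real m) ^ t \<le> (4 * real n / real m) ^ s"
    using assms by (intro power_increasing) (auto simp: field_simps)
  finally have "real N / real E * (real b - real m) \<le> real (Suc s) * (4 * real n / real m) ^ s"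
    by (simp add: mult_left_mono)
  then show ?thesis using assms by (simp add: pos_le_divide_eq)
qed

lemma prob_contains_ge:
  assumes pat: "vincular_pattern \<pi> A" and s: "s = max_super_inversions \<pi> A"
    and l: "l = length (supercomponents \<pi> A)" and m: "2 * s \<le> m" "0 < m" "m < n" "m < n div (l * length \<pi>)"
  shows "1 - real l * (real (Suc s) * (4 * real n / real m) ^ s / (real (n div (l * length \<pi>)) - real m))
    \<le> measure_pmf.prob (random_perm n m) {\<sigma>. contains_vincular \<sigma> \<pi> A}"
proof -
  note \<pi> = is_perm_of_vincular_pattern[OF pat]
  define \<beta>s where "\<beta>s = supercomponents \<pi> A"
  note st = supercomponents_structure[OF \<pi>(1), where A = A, folded \<beta>s_def]
  have l: "l = length \<beta>s" by (simp add: l \<beta>s_def)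
  define Q where "Q = n div (l * length \<pi>)"
  have Q: "l * Q * length \<pi> \<le> n"
    unfolding Q_def using div_times_less_eq_dividend[of n "l * length \<pi>"] by (simp add: mult_ac)
  let ?E = "card (inv_tables n m)"
  let ?occ = "\<lambda>j. occurrences (length \<pi>) {j * Q..<Suc j * Q} (length (\<beta>s ! j)) (inv_table (\<beta>s ! j))"
  let ?N = "\<lambda>j. card {e \<in> inv_tables n m. ?occ j e = {}}"
  let ?b = "real (Suc s) * (4 * real n / real m) ^ s / (real Q - real m)"
  have E: "0 < ?E" using inv_tables_nonempty[OF m(3)] by (simp add: card_gt_0_iff)
  have each: "real (?N j) / real ?E \<le> ?b" if j: "j < l" for j
  proof (rule no_occurrence_fraction_le)
    let ?t = "num_inversions (\<beta>s ! j)"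
    show "?t \<le> s"
      unfolding s max_super_inversions_def using j by (intro Max_ge) (auto simp: l \<beta>s_def)
    have len: "length (\<beta>s ! j) \<le> length \<pi>"
      using offset_less[of j l \<beta>s] st(1) j l by (metis length_direct_sums add_leE)
    have "?N j * (m - ?t) ^ ?t * (card {j * Q..<Suc j * Q} - m) \<le> ?E * Suc ?t * (n + m) ^ ?t"
    proof (rule card_no_occurrence)
      show "u * length \<pi> + length (\<beta>s ! j) \<le> n" if "u \<in> {j * Q..<Suc j * Q}" for u
      proof -
        have "Suc u \<le> Suc j * Q" using that by auto
        also have "\<dots> \<le> l * Q" using j by (intro mult_le_mono1) simp
        finally have "Suc u * length \<pi> \<le> l * Q * length \<pi>" by (rule mult_le_mono1)
        then show ?thesis using len Q by simp
      qed
      show "?t \<le> m" using \<open>?t \<le> s\<close> m(1) by simp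
    qed (use len in \<open>auto simp: inv_table_le sum_inv_table\<close>)
    then show "?N j * (m - ?t) ^ ?t * (Q - m) \<le> ?E * Suc ?t * (n + m) ^ ?t" by simp
  qed (use m E Q_def in auto)
  have "measure_pmf.prob (random_perm n m) {\<sigma>. \<not> contains_vincular \<sigma> \<pi> A}
      \<le> card {e \<in> inv_tables n m. \<exists>j<l. ?occ j e = {}} / ?E"
  proof (rule prob_random_perm_le[OF m(3)])
    fix \<sigma> assume \<sigma>: "\<sigma> \<in> perms_with_inversions n m" and "\<not> contains_vincular \<sigma> \<pi> A"
    then show "\<exists>j<l. ?occ j (inv_table \<sigma>) = {}"
      using contains_if_occurrences[OF pat perms_with_inversionsD(2)[OF \<sigma>], of Q]
        perms_with_inversionsD(1)[OF \<sigma>] Q l by (auto simp: \<beta>s_def)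
  qed
  also have "\<dots> \<le> (\<Sum>j<l. real (?N j)) / ?E"
  proof (rule divide_right_mono)
    have "{e \<in> inv_tables n m. \<exists>j<l. ?occ j e = {}} = (\<Union>j<l. {e \<in> inv_tables n m. ?occ j e = {}})" by auto
    then have "card {e \<in> inv_tables n m. \<exists>j<l. ?occ j e = {}} \<le> (\<Sum>j<l. ?N j)"
      using card_UN_le[of "{..<l}" "\<lambda>j. {e \<in> inv_tables n m. ?occ j e = {}}"] by simp
    then show "real (card {e \<in> inv_tables n m. \<exists>j<l. ?occ j e = {}}) \<le> (\<Sum>j<l. real (?N j))"
      unfolding of_nat_sum[symmetric] by (rule of_nat_mono)
  qed simp
  also have "\<dots> = (\<Sum>j<l. real (?N j) / real ?E)" by (rule sum_divide_distrib)
  also have "\<dots> \<le> (\<Sum>j<l. ?b)" by (rule sum_mono) (use each in simp)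
  also have "\<dots> = real l * ?b" by simp
  finally have "measure_pmf.prob (random_perm n m) {\<sigma>. \<not> contains_vincular \<sigma> \<pi> A} \<le> real l * ?b" .
  moreover have "measure_pmf.prob (random_perm n m) {\<sigma>. \<not> contains_vincular \<sigma> \<pi> A}
      = 1 - measure_pmf.prob (random_perm n m) {\<sigma>. contains_vincular \<sigma> \<pi> A}"
    using measure_pmf.prob_compl[of "{\<sigma>. contains_vincular \<sigma> \<pi> A}" "random_perm n m"]
    by (simp add: Compl_eq_Diff_UNIV[symmetric] Collect_neg_eq)
  ultimately show ?thesis by (simp add: Q_def)
qed

section \<open>Limits for few inversions\<close>

lemma threshold_power:
  assumes "0 < s" "0 < n"
  shows "(real n powr (1 - 1 / real s)) ^ s = real n ^ s / real n"
proof -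
  have "(real n powr (1 - 1 / real s)) ^ s = real n powr ((1 - 1 / real s) * real s)"
    using assms by (simp add: powr_power mult.commute)
  also have "(1 - 1 / real s) * real s = real s - 1" using assms by (simp add: field_simps)
  also have "real n powr (real s - 1) = real n ^ s / real n"
    using assms by (simp add: powr_diff powr_realpow)
  finally show ?thesis .
qed

lemma threshold_le:
  assumes "0 < s" "0 < n"
  shows "1 \<le> real n powr (1 - 1 / real s)" "real n powr (1 - 1 / real s) \<le> real n"
proof -
  have "1 \<le> real n" using assms by simp
  then show "1 \<le> real n powr (1 - 1 / real s)"
    using assms by (intro ge_one_powr_ge_zero) auto
  have "real n powr (1 - 1 / real s) \<le> real n powr 1"
    using \<open>1 \<le> real n\<close> by (intro powr_mono) auto
  then show "real n powr (1 - 1 / real s) \<le> real n" using assms by simp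
qed

text \<open>
  Eventually \<open>m n \<le> n / 2\<close>, and then the bound for fixed \<open>n\<close> is a constant times
  \<open>n * (m n / n) ^ s\<close>, the \<open>s\<close>th power of the quotient of \<open>m n\<close> by the threshold.
\<close>
lemma prob_contains_tendsto_0:
  fixes m :: "nat \<Rightarrow> nat"
  assumes pat: "vincular_pattern \<pi> A" and s: "s = max_super_inversions \<pi> A" "0 < s"
    and m: "(\<lambda>n. real (m n)) \<lless> (\<lambda>n. real n powr (1 - 1 / real s))"
  shows "(\<lambda>n. measure_pmf.prob (random_perm n (m n)) {\<sigma>. contains_vincular \<sigma> \<pi> A}) \<longlonglongrightarrow> 0"
proof -
  define K where "K = 2 * (s + Suc (length \<pi>))"
  define r where "r n = real (m n) / real n powr (1 - 1 / real s)" for n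
  have "r \<longlonglongrightarrow> 0" unfolding r_def using smalloD_tendsto[OF m] .
  then have "(\<lambda>n. (2 * real K) ^ s * r n ^ s) \<longlonglongrightarrow> (2 * real K) ^ s * 0 ^ s"
    by (intro tendsto_intros)
  then have lim: "(\<lambda>n. (2 * real K) ^ s * r n ^ s) \<longlonglongrightarrow> 0" using s(2) by (simp add: power_0_left)
  have "eventually (\<lambda>n. norm (real (m n)) \<le> 1/2 * norm (real n powr (1 - 1 / real s))) sequentially"
    by (rule landau_o.smallD[OF m]) simp
  then have ev: "eventually (\<lambda>n. measure_pmf.prob (random_perm n (m n)) {\<sigma>. contains_vincular \<sigma> \<pi> A}
      \<le> (2 * real K) ^ s * r n ^ s) sequentially"
    using eventually_gt_at_top[of 0]
  proof eventually_elim
    case (elim n)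
    then have m_le: "real (m n) \<le> real n / 2" using threshold_le(2)[OF s(2) elim(2)] by simp
    then have "m n < n" using elim(2) by linarith
    have "measure_pmf.prob (random_perm n (m n)) {\<sigma>. contains_vincular \<sigma> \<pi> A}
        \<le> real n * (real K * real (m n)) ^ s / real (n - m n) ^ s"
      using prob_contains_le[OF pat s \<open>m n < n\<close>] by (simp add: K_def)
    also have "\<dots> \<le> real n * (real K * real (m n)) ^ s / (real n / 2) ^ s"
      using m_le elim(2) \<open>m n < n\<close> by (intro divide_left_mono power_mono mult_pos_pos zero_less_power) auto
    also have "\<dots> = (2 * real K) ^ s * (real (m n) ^ s / (real n ^ s / real n))"
      using elim(2) by (simp add: power_mult_distrib power_divide field_simps)
    also have "\<dots> = (2 * real K) ^ s * r n ^ s"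
      unfolding r_def power_divide threshold_power[OF s(2) elim(2)] ..
    finally show ?case .
  qed
  show ?thesis
    by (rule tendsto_sandwich[OF _ ev tendsto_const lim]) simp
qed

text \<open>
  The number \<open>n div d\<close> of blocks in a segment is linear in \<open>n\<close>, and so is its excess over \<open>m n = o(n)\<close>,
  and the failure probability is at most a constant times \<open>(n / m n) ^ s / n\<close>, the \<open>s\<close>th power of the
  quotient of the threshold by \<open>m n\<close>.
\<close>
lemma prob_contains_tendsto_1:
  fixes m :: "nat \<Rightarrow> nat"
  assumes pat: "vincular_pattern \<pi> A" and s: "s = max_super_inversions \<pi> A" "0 < s"
    and lower: "(\<lambda>n. real n powr (1 - 1 / real s)) \<lless> (\<lambda>n. real (m n))"
    and upper: "(\<lambda>n. real (m n)) \<lless> (\<lambda>n. real n)"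
  shows "(\<lambda>n. measure_pmf.prob (random_perm n (m n)) {\<sigma>. contains_vincular \<sigma> \<pi> A}) \<longlonglongrightarrow> 1"
proof -
  define l where "l = length (supercomponents \<pi> A)"
  define d where "d = l * length \<pi>"
  define C where "C = real l * (real (Suc s) * 4 ^ s * (2 * real d))"
  define r where "r n = real n powr (1 - 1 / real s) / real (m n)" for n
  have d: "0 < d"
    using supercomponents_nonempty[OF pat] is_perm_of_vincular_pattern(3)[OF pat] by (simp add: d_def l_def)
  have "r \<longlonglongrightarrow> 0" unfolding r_def using smalloD_tendsto[OF lower] .
  then have "(\<lambda>n. 1 - C * r n ^ s) \<longlonglongrightarrow> 1 - C * 0 ^ s"
    by (intro tendsto_intros)
  then have lim: "(\<lambda>n. 1 - C * r n ^ s) \<longlonglongrightarrow> 1" using s(2) by (simp add: power_0_left)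
  \<comment> \<open>Since the threshold is at least \<open>1\<close>, this bound gives \<open>2 * s \<le> m n\<close>.\<close>
  have "eventually (\<lambda>n. norm (real n powr (1 - 1 / real s)) \<le> 1 / (2 * real s) * norm (real (m n))) sequentially"
    by (rule landau_o.smallD[OF lower]) (use s(2) in simp)
  \<comment> \<open>With \<open>m n \<le> n / (4 * d)\<close>, at least \<open>n / (2 * d)\<close> blocks of each segment remain.\<close>
  moreover have "eventually (\<lambda>n. norm (real (m n)) \<le> 1 / (4 * real d) * norm (real n)) sequentially"
    by (rule landau_o.smallD[OF upper]) (use d in simp)
  ultimately have ev: "eventually (\<lambda>n. 1 - C * r n ^ s
      \<le> measure_pmf.prob (random_perm n (m n)) {\<sigma>. contains_vincular \<sigma> \<pi> A}) sequentially"
    using eventually_ge_at_top[of "4 * d + 1"]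
  proof eventually_elim
    case (elim n)
    have n: "0 < n" using elim(3) by simp
    have "1 \<le> 1 / (2 * real s) * real (m n)" using elim(1) threshold_le(1)[OF s(2) n] by simp
    then have m1: "2 * s \<le> m n" using s(2) by (simp add: field_simps)
    then have m2: "0 < m n" using s(2) by simp
    have m3: "real (m n) * (4 * real d) \<le> real n" using elim(2) d by (simp add: field_simps)
    have quot: "real n / (2 * real d) \<le> real (n div d) - real (m n)"
    proof -
      have "n < Suc (n div d) * d" using d by (metis dividend_less_div_times mult_Suc add.commute)
      then have "real n < (real (n div d) + 1) * real d"
        by (metis of_nat_less_iff of_nat_mult of_nat_Suc add.commute)
      then have "real n / real d < real (n div d) + 1" using d by (simp add: pos_divide_less_eq)
      moreover have "real (m n) \<le> real n / real d / 4" using m3 d by (simp add: field_simps)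
      moreover have "1 \<le> real n / real d / 4" using elim(3) d by (simp add: field_simps)
      moreover have "real n / (2 * real d) = real n / real d / 2" by simp
      ultimately show ?thesis by linarith
    qed
    have pos: "0 < real n / (2 * real d)" using n d by simp
    have m4: "m n < n div d" using quot pos by linarith
    then have m5: "m n < n" using div_le_dividend[of n d] by linarith
    have "real (Suc s) * (4 * real n / real (m n)) ^ s / (real (n div d) - real (m n))
        \<le> real (Suc s) * (4 * real n / real (m n)) ^ s / (real n / (2 * real d))"
      using quot pos by (intro divide_left_mono mult_pos_pos) auto
    also have "\<dots> = real (Suc s) * 4 ^ s * (2 * real d) * (real n ^ s / real n / real (m n) ^ s)"
      using n m2 d by (simp add: power_mult_distrib power_divide field_simps)
    also have "\<dots> = real (Suc s) * 4 ^ s * (2 * real d) * r n ^ s"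
      unfolding r_def power_divide threshold_power[OF s(2) n] ..
    finally have "real l * (real (Suc s) * (4 * real n / real (m n)) ^ s / (real (n div d) - real (m n)))
        \<le> real l * (real (Suc s) * 4 ^ s * (2 * real d) * r n ^ s)"
      by (rule mult_left_mono) simp
    also have "\<dots> = C * r n ^ s" by (simp add: C_def mult.assoc)
    finally have "real l * (real (Suc s) * (4 * real n / real (m n)) ^ s / (real (n div d) - real (m n)))
        \<le> C * r n ^ s" .
    then show ?case
      using prob_contains_ge[OF pat s(1) l_def m1 m2 m5] m4 by (simp add: d_def)
  qed
  show ?thesis
    by (rule tendsto_sandwich[OF ev _ lim tendsto_const]) simp
qed

section \<open>Complementation\<close>

lemma complement_nth: "i < length \<sigma> \<Longrightarrow> complement \<sigma> ! i = length \<sigma> + 1 - \<sigma> ! i"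
  by (simp add: complement_def)

lemma length_complement [simp]: "length (complement \<sigma>) = length \<sigma>"
  by (simp add: complement_def)

lemma is_perm_nth_le: "is_perm \<sigma> \<Longrightarrow> i < length \<sigma> \<Longrightarrow> \<sigma> ! i \<le> length \<sigma>"
  using nth_mem[of i \<sigma>] by (auto simp: is_perm_iff)

lemma complement_complement:
  assumes "is_perm \<sigma>" shows "complement (complement \<sigma>) = \<sigma>"
proof (rule nth_equalityI)
  show "complement (complement \<sigma>) ! i = \<sigma> ! i" if "i < length (complement (complement \<sigma>))" for i
    using that is_perm_nth_le[OF assms, of i] by (simp add: complement_nth)
qed simp

lemma is_perm_complement:
  assumes "is_perm \<sigma>" shows "is_perm (complement \<sigma>)"
proof -
  have "set (complement \<sigma>) = (\<lambda>x. length \<sigma> + 1 - x) ` {1..length \<sigma>}"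
    using assms by (simp add: complement_def is_perm_iff)
  also have "\<dots> = {1..length \<sigma>}"
  proof
    show "{1..length \<sigma>} \<subseteq> (\<lambda>x. length \<sigma> + 1 - x) ` {1..length \<sigma>}"
    proof
      fix y assume "y \<in> {1..length \<sigma>}"
      then show "y \<in> (\<lambda>x. length \<sigma> + 1 - x) ` {1..length \<sigma>}"
        by (intro image_eqI[of _ _ "length \<sigma> + 1 - y"]) auto
    qed
  qed auto
  finally show ?thesis by (simp add: is_perm_iff)
qed

lemma complement_less_iff:
  assumes "is_perm \<sigma>" "i < length \<sigma>" "j < length \<sigma>"
  shows "complement \<sigma> ! i < complement \<sigma> ! j \<longleftrightarrow> \<sigma> ! j < \<sigma> ! i"
  using assms(2,3) is_perm_nth_le[OF assms(1,2)] is_perm_nth_le[OF assms(1,3)]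
  by (auto simp: complement_nth)

lemma contains_vincular_complement:
  assumes "is_perm \<sigma>" "is_perm \<pi>"
  shows "contains_vincular (complement \<sigma>) (complement \<pi>) A \<longleftrightarrow> contains_vincular \<sigma> \<pi> A"
proof -
  have *: "contains_vincular (complement \<sigma>) (complement \<pi>) A"
    if perms: "is_perm \<sigma>" "is_perm \<pi>" and cont: "contains_vincular \<sigma> \<pi> A" for \<sigma> \<pi>
  proof -
    obtain f where f: "strict_mono_on {..<length \<pi>} f" "f ` {..<length \<pi>} \<subseteq> {..<length \<sigma>}"
      "\<forall>a<length \<pi>. \<forall>b<length \<pi>. \<sigma> ! f a < \<sigma> ! f b \<longleftrightarrow> \<pi> ! a < \<pi> ! b"
      "\<forall>t\<in>A. f t = f (t - 1) + 1"
      using cont unfolding contains_vincular_def by blast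
    then show ?thesis
      unfolding contains_vincular_def
      using perms by (intro exI[of _ f]) (auto simp: complement_less_iff image_subset_iff)
  qed
  show ?thesis
    using *[OF assms] *[OF is_perm_complement[OF assms(1)] is_perm_complement[OF assms(2)]]
      complement_complement[OF assms(1)] complement_complement[OF assms(2)] by auto
qed

lemma vincular_pattern_complement: "vincular_pattern \<pi> A \<Longrightarrow> vincular_pattern (complement \<pi>) A"
  by (auto simp: vincular_pattern_def is_perm_complement) (simp add: complement_def)

lemma num_inversions_complement:
  assumes "is_perm \<sigma>"
  shows "num_inversions \<sigma> + num_inversions (complement \<sigma>) = length \<sigma> choose 2"
proof -
  let ?n = "length \<sigma>"
  have dist: "distinct \<sigma>" using assms by (simp add: is_perm_def permutations_of_set_def)
  let ?I = "{(i, j). i < j \<and> j < ?n \<and> \<sigma> ! i > \<sigma> ! j}"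
  let ?J = "{(i, j). i < j \<and> j < ?n \<and> \<sigma> ! i < \<sigma> ! j}"
  have fin: "finite {(i, j). i < j \<and> j < ?n}"
    by (rule finite_subset[of _ "{..<?n} \<times> {..<?n}"]) auto
  have "num_inversions (complement \<sigma>) = card ?J"
    unfolding num_inversions_def using complement_less_iff[OF assms]
    by (intro arg_cong[of _ _ card]) auto
  moreover have "card (?I \<union> ?J) = card ?I + card ?J"
    by (rule card_Un_disjoint) (auto intro: finite_subset[OF _ fin])
  moreover have "?I \<union> ?J = prod.swap ` (SIGMA j:{..<?n}. {..<j})"
  proof -
    have "\<sigma> ! i \<noteq> \<sigma> ! j" if "i < j" "j < ?n" for i j
      using dist that by (simp add: nth_eq_iff_index_eq)
    then have "?I \<union> ?J = {(i, j). i < j \<and> j < ?n}"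
      by (auto simp: neq_iff)
    also have "\<dots> = prod.swap ` (SIGMA j:{..<?n}. {..<j})"
      by (auto simp: image_iff Bex_def)
    finally show ?thesis .
  qed
  moreover have "card (prod.swap ` (SIGMA j:{..<?n}. {..<j})) = (\<Sum>j<?n. j)"
    by (subst card_image) auto
  moreover have "(\<Sum>j<k. j) = k choose 2" for k :: nat
    by (induction k) (auto simp: numeral_2_eq_2)
  ultimately show ?thesis by (simp add: num_inversions_def)
qed

lemma bij_betw_complement:
  assumes "m \<le> n choose 2"
  shows "bij_betw complement (perms_with_inversions n m) (perms_with_inversions n ((n choose 2) - m))"
proof -
  have mem: "complement \<sigma> \<in> perms_with_inversions n ((n choose 2) - m)"
    if "\<sigma> \<in> perms_with_inversions n m" for \<sigma> m
  proof -
    note P = perms_with_inversionsD[OF that]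
    have "num_inversions \<sigma> = m" using that by (simp add: perms_with_inversions_def)
    then have "num_inversions (complement \<sigma>) = (n choose 2) - m"
      using num_inversions_complement[OF P(3)] P(1) by simp
    moreover have "complement \<sigma> \<in> permutations_of_set {1..n}"
      using is_perm_complement[OF P(3)] P(1) by (simp add: is_perm_def)
    ultimately show ?thesis by (simp add: perms_with_inversions_def)
  qed
  have twice: "(n choose 2) - ((n choose 2) - m) = m" using assms by simp
  show ?thesis
    by (rule bij_betw_byWitness[where f' = complement])
      (use mem[of _ m] mem[of _ "(n choose 2) - m"] twice perms_with_inversionsD(3) complement_complement in auto)
qed

text \<open>
  The assumption \<open>(n choose 2) - m < n\<close> makes sure that there are permutations with \<open>m\<close>
  inversions: the uniform distribution on an empty set carries no information.
\<close>
lemma prob_contains_complement: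
  assumes "is_perm \<pi>" "m \<le> n choose 2" "(n choose 2) - m < n"
  shows "measure_pmf.prob (random_perm n m) {\<sigma>. contains_vincular \<sigma> \<pi> A}
    = measure_pmf.prob (random_perm n ((n choose 2) - m)) {\<sigma>. contains_vincular \<sigma> (complement \<pi>) A}"
proof -
  let ?m = "(n choose 2) - m"
  note bij = bij_betw_complement[OF assms(2)]
  have ne: "perms_with_inversions n ?m \<noteq> {}" by (rule perms_with_inversions_nonempty[OF assms(3)])
  then have ne': "perms_with_inversions n m \<noteq> {}" using bij by (auto simp: bij_betw_def)
  have "bij_betw complement {\<sigma> \<in> perms_with_inversions n m. contains_vincular \<sigma> \<pi> A}
      {\<sigma> \<in> perms_with_inversions n ?m. contains_vincular \<sigma> (complement \<pi>) A}"
    using contains_vincular_complement[OF perms_with_inversionsD(3) assms(1)]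
    by (intro bij_betw_Collect[OF bij]) auto
  then show ?thesis
    using bij_betw_same_card[OF bij] by (simp add: prob_random_perm ne ne' bij_betw_same_card)
qed

section \<open>The threshold theorem\<close>

theorem theorem3:
  fixes \<pi> :: "nat list" and A :: "nat set" and m :: "nat \<Rightarrow> nat" and s s' :: nat
  assumes "vincular_pattern \<pi> A"
    and "\<And>n. m n \<le> n choose 2"
    and "s = max_super_inversions \<pi> A"
    and "s' = max_super_inversions (complement \<pi>) A"
  defines "p \<equiv> \<lambda>n. measure_pmf.prob (random_perm n (m n)) {\<sigma>. contains_vincular \<sigma> \<pi> A}"
  shows
    "(s > 0 \<longrightarrow>
       ((\<lambda>n. real (m n)) \<lless> (\<lambda>n. real n powr (1 - 1 / real s)) \<longrightarrow> p \<longlonglongrightarrow> 0) \<and>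
       ((\<lambda>n. real n powr (1 - 1 / real s)) \<lless> (\<lambda>n. real (m n)) \<and>
        (\<lambda>n. real (m n)) \<lless> (\<lambda>n. real n) \<longrightarrow> p \<longlonglongrightarrow> 1)) \<and>
     (s' > 0 \<longrightarrow>
       ((\<lambda>n. real (n choose 2) - real (m n)) \<lless> (\<lambda>n. real n) \<and>
        (\<lambda>n. real n powr (1 - 1 / real s')) \<lless> (\<lambda>n. real (n choose 2) - real (m n)) \<longrightarrow>
          p \<longlonglongrightarrow> 1) \<and>
       ((\<lambda>n. real (n choose 2) - real (m n)) \<lless> (\<lambda>n. real n powr (1 - 1 / real s')) \<longrightarrow>
          p \<longlonglongrightarrow> 0))"
proof -
  define m' where "m' n = (n choose 2) - m n" for n
  define p' where "p' n = measure_pmf.prob (random_perm n (m' n)) {\<sigma>. contains_vincular \<sigma> (complement \<pi>) A}" for n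
  have m': "real (n choose 2) - real (m n) = real (m' n)" for n
    using assms(2)[of n] by (simp add: m'_def of_nat_diff)
  note pat' = vincular_pattern_complement[OF assms(1)]
  have transfer: "p \<longlonglongrightarrow> L" if lim: "p' \<longlonglongrightarrow> L" and small: "eventually (\<lambda>n. m' n < n) sequentially" for L
  proof -
    have "eventually (\<lambda>n. p n = p' n) sequentially"
      using small
    proof eventually_elim
      case (elim n)
      then show ?case
        unfolding p_def p'_def m'_def
        using assms(1,2) by (intro prob_contains_complement) (auto simp: vincular_pattern_def)
    qed
    then show ?thesis using lim by (simp add: tendsto_cong)
  qed
  have small: "eventually (\<lambda>n. m' n < n) sequentially" if "(\<lambda>n. real (m' n)) \<lless> (\<lambda>n. real n)"
  proof -
    have "eventually (\<lambda>n. norm (real (m' n)) \<le> 1/2 * norm (real n)) sequentially"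
      by (rule landau_o.smallD[OF that]) simp
    then show ?thesis using eventually_gt_at_top[of 0] by eventually_elim simp
  qed
  have small': "eventually (\<lambda>n. m' n < n) sequentially"
    if "(\<lambda>n. real (m' n)) \<lless> (\<lambda>n. real n powr (1 - 1 / real s'))" "0 < s'"
  proof -
    have "eventually (\<lambda>n. norm (real (m' n)) \<le> 1/2 * norm (real n powr (1 - 1 / real s'))) sequentially"
      by (rule landau_o.smallD[OF that(1)]) simp
    then show ?thesis using eventually_gt_at_top[of 0]
    proof eventually_elim
      case (elim n)
      then show ?case using threshold_le(2)[OF that(2) elim(2)] by simp
    qed
  qed
  show ?thesis
    unfolding m'
    using prob_contains_tendsto_0[OF assms(1,3)] prob_contains_tendsto_1[OF assms(1,3)]
      prob_contains_tendsto_0[OF pat' assms(4), of m', folded p'_def]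
      prob_contains_tendsto_1[OF pat' assms(4), of m', folded p'_def] transfer small small'
    by (auto simp: p_def p'_def[abs_def])
qed

end
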